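(* Let $A$ be a finite alphabet with $|A|\ge 2$, let $\phi\colon A^\star\to[0,\infty)$, let $\mathcal T$ be the set of irreducible trees on $A$ equipped with the Hamming distance $d_\phi$, let $\mathcal P$ be the set of all stationary ergodic probability measures on $A^{\mathbb Z}$, and let $T\colon\mathcal P\to\mathcal T$, $T(P)=\tau_P$, be the functional assigning to each $P\in\mathcal P$ its context tree. Then $T$ is consistently estimable on $\mathcal P$ (in probability, with respect to $d_\phi$) if and only if $\sum_{v\in A^\star}\phi(v)<+\infty$.
   Context: Strings. $A^\star=\bigcup_{j\ge 0}A^j$ is the set of finite strings over $A$, including the empty string $\lambda$; $A^\infty$ is the set of left-infinite sequences $\ldots a_{-2}a_{-1}$ over $A$. $|w|$ is the length of $w$. $w$ is a suffix of $s$ if $s=vw$ for some (finite or left-infinite) $v$; it is a proper suffix if moreover $|v|\ge1$. Trees. A tree $\tau$ is a set of finite strings and/or left-infinite sequences (its leaves) such that no $w\in\tau$ is a proper suffix of another $s\in\tau$. It is irreducible if no $w\in\tau$ can be replaced by a proper suffix of $w$ without violating the tree property. A node of $\tau$ is a finite string that is a suffix (proper or not) of some $s\in\tau$; $\bar\tau\subset A^\star$ denotes the set of nodes, and $\tau$ is identified with $\bar\tau$. $\mathcal T$ is the set of irreducible trees. The Hamming distance is $$d_\phi(\tau,\tau')=\sum_{v\in A^\star}\phi(v)\,\bigl|\mathbf 1_{\{v\in\bar\tau\}}-\mathbf 1_{\{v\in\bar\tau'\}}\bigr|$$ (it may take the value $+\infty$ when $\phi$ is not summable). Measures and contexts. $\mathcal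 P$ is the set of shift-invariant ergodic probability measures on $A^{\mathbb Z}$ with the product $\sigma$-algebra; $(X_i)_{i\in\mathbb Z}$ is the coordinate process. For $s\in A^\star$, $P(s)$ is the probability that $|s|$ consecutive coordinates form $s$ ($P(\lambda)=1$), and if $P(s)>0$, $P(a|s)=P(X_0=a\mid X_{-|s|}^{-1}=s)$, with $P(a|\lambda)=P(X_0=a)$. A finite string $s$ is a context of $P$ if: (1) $P(s)>0$ or $s=\lambda$; (2) $P(a|v)=P(a|s)$ for all $a\in A$ and all $v\in A^\star$ with $P(v)>0$ having $s$ as a suffix; (3) no proper suffix of $s$ satisfies (2). An infinite context is a left-infinite sequence $x_{-\infty}^{-1}$ all of whose finite suffixes $x_{-n}^{-1}$, $n\ge1$, have positive probability but none of them is a context. The set of all contexts (finite and infinite) of $P$ is an irreducible tree, the context tree $\tau_P$. Consistency. $T$ is consistently estimable on $\mathcal P$ if there is a sequence of functions $T_n\colon A^n\to\mathcal T$ ($n\in\mathbb N$) such that for every $P\in\mathcal P$, $d_\phi(T_n(X_1,\dots,X_n),\tau_P)\to 0$ in $P$-probability as $n\to\infty$.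
   Formalization: In the definition of an infinite context, the empty suffix λ is also required not to be a context (the source says n ≥ 1); otherwise an i.i.d. process would have both λ and left-infinite sequences as contexts, which is not a tree. *)

theory Defs
  imports "HOL-Probability.Probability" "HOL-Library.Sublist" "HOL-Library.Stream"
begin

text \<open>
  Finite strings over the alphabet are lists, written left to right, so that the last list
  element is the most recent symbol. A left-infinite sequence \<open>\<dots> a\<^sub>-\<^sub>2 a\<^sub>-\<^sub>1\<close> is encoded by the
  stream \<open>a\<^sub>-\<^sub>1, a\<^sub>-\<^sub>2, \<dots>\<close> that reads it from right to left; hence the concatenation of a
  left-infinite \<open>y\<close> with a finite string \<open>w\<close> on its right is the stream \<open>rev w @- y\<close>.
\<close>

datatype 'a sequence = Fin "'a list" | LInf "'a stream"

fun is_suffix :: "'a list \<Rightarrow> 'a sequence \<Rightarrow> bool" where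
  "is_suffix w (Fin s) \<longleftrightarrow> suffix w s"
| "is_suffix w (LInf x) \<longleftrightarrow> (\<exists>y. x = rev w @- y)"

fun is_proper_suffix :: "'a list \<Rightarrow> 'a sequence \<Rightarrow> bool" where
  "is_proper_suffix w (Fin s) \<longleftrightarrow> strict_suffix w s"
| "is_proper_suffix w (LInf x) \<longleftrightarrow> (\<exists>y. x = rev w @- y)"

text \<open>
  Only finite strings can be proper suffixes: if \<open>w\<close> is left-infinite, then \<open>s = v w\<close> forces
  \<open>v\<close> to be empty. So left-infinite leaves impose no condition in the role of \<open>w\<close> below.
\<close>

definition is_tree :: "'a sequence set \<Rightarrow> bool" where
  "is_tree \<tau> \<longleftrightarrow> (\<forall>w s. Fin w \<in> \<tau> \<longrightarrow> s \<in> \<tau> \<longrightarrow> \<not> is_proper_suffix w s)"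

definition irreducible_trees :: "'a sequence set set" where
  "irreducible_trees = {\<tau>. is_tree \<tau> \<and>
     (\<forall>w\<in>\<tau>. \<forall>u. is_proper_suffix u w \<longrightarrow> \<not> is_tree (insert (Fin u) (\<tau> - {w})))}"

definition nodes :: "'a sequence set \<Rightarrow> 'a list set" where
  "nodes \<tau> = {u. \<exists>s\<in>\<tau>. is_suffix u s}"

definition hamming_dist ::
    "('a list \<Rightarrow> real) \<Rightarrow> 'a sequence set \<Rightarrow> 'a sequence set \<Rightarrow> ennreal" where
  "hamming_dist \<phi> \<tau> \<tau>' =
     (\<Sum>\<^sub>\<infinity>v\<in>UNIV. ennreal (\<phi> v * \<bar>indicator (nodes \<tau>) v - indicator (nodes \<tau>') v\<bar>))"

definition seq_space :: "(int \<Rightarrow> 'a) measure" where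
  "seq_space = PiM UNIV (\<lambda>_. count_space UNIV)"

definition left_shift :: "(int \<Rightarrow> 'a) \<Rightarrow> int \<Rightarrow> 'a" where
  "left_shift \<omega> i = \<omega> (i + 1)"

definition stationary_ergodic :: "(int \<Rightarrow> 'a) measure set" where
  "stationary_ergodic = {P. prob_space P \<and> sets P = sets seq_space \<and>
     distr P P left_shift = P \<and>
     (\<forall>E\<in>sets P. left_shift -` E = E \<longrightarrow> measure P E = 0 \<or> measure P E = 1)}"

definition past_is :: "'a list \<Rightarrow> (int \<Rightarrow> 'a) \<Rightarrow> bool" where
  "past_is s \<omega> \<longleftrightarrow> map \<omega> [- int (length s)..- 1] = s"

definition string_prob :: "(int \<Rightarrow> 'a) measure \<Rightarrow> 'a list \<Rightarrow> real" where
  "string_prob P s = \<P>(\<omega> in P. past_is s \<omega>)"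

definition next_prob :: "(int \<Rightarrow> 'a) measure \<Rightarrow> 'a \<Rightarrow> 'a list \<Rightarrow> real" where
  "next_prob P a s = \<P>(\<omega> in P. \<omega> 0 = a \<bar> past_is s \<omega>)"

definition determines_next :: "(int \<Rightarrow> 'a) measure \<Rightarrow> 'a list \<Rightarrow> bool" where
  "determines_next P s \<longleftrightarrow>
     (\<forall>a v. string_prob P v > 0 \<longrightarrow> suffix s v \<longrightarrow> next_prob P a v = next_prob P a s)"

definition is_context :: "(int \<Rightarrow> 'a) measure \<Rightarrow> 'a list \<Rightarrow> bool" where
  "is_context P s \<longleftrightarrow> (string_prob P s > 0 \<or> s = []) \<and> determines_next P s \<and>
     \<not> (\<exists>u. strict_suffix u s \<and> determines_next P u)"

text \<open>
  The empty suffix is included here: otherwise every positive-probability left-infinite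
  sequence would be an infinite context of an i.i.d. process, next to its context \<open>\<lambda>\<close>.
\<close>

definition is_infinite_context :: "(int \<Rightarrow> 'a) measure \<Rightarrow> 'a stream \<Rightarrow> bool" where
  "is_infinite_context P x \<longleftrightarrow>
     (\<forall>w. is_suffix w (LInf x) \<longrightarrow> string_prob P w > 0 \<and> \<not> is_context P w)"

definition context_tree :: "(int \<Rightarrow> 'a) measure \<Rightarrow> 'a sequence set" where
  "context_tree P = Fin ` {s. is_context P s} \<union> LInf ` {x. is_infinite_context P x}"

definition consistently_estimable ::
    "('a list \<Rightarrow> real) \<Rightarrow> (int \<Rightarrow> 'a) measure set \<Rightarrow>
     ((int \<Rightarrow> 'a) measure \<Rightarrow> 'a sequence set) \<Rightarrow> bool" where
  "consistently_estimable \<phi> \<M> T \<longleftrightarrow>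
     (\<exists>T_est :: nat \<Rightarrow> 'a list \<Rightarrow> 'a sequence set.
        (\<forall>n x. length x = n \<longrightarrow> T_est n x \<in> irreducible_trees) \<and>
        (\<forall>P\<in>\<M>. \<forall>\<epsilon>>0::real.
           (\<lambda>n. \<P>(\<omega> in P. hamming_dist \<phi> (T_est n (map \<omega> [1..int n])) (T P) > ennreal \<epsilon>))
             \<longlonglongrightarrow> 0))"

end

theory Submission
  imports Defs "HOL-Real_Asymp.Real_Asymp"
begin

text \<open>
  If the weights are summable, all but a small amount of weight sits on finitely many strings, so it
  suffices to decide for each single string \<open>v\<close>, with error probability tending to 0, whether it is a
  node of the context tree. It is one iff it has positive probability and none of its proper suffixes
  \<open>u\<close> determines the next symbol (\<open>nodes_context_tree\<close>). No rate of convergence is available over all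
  ergodic processes, but none is required: if \<open>u\<close> does determine the next symbol, then the deviation
  of the number of visits to an extension \<open>w\<close> of \<open>u\<close> that are followed by \<open>a\<close> from its conditional
  mean is a martingale with bounded increments, hence of order \<open>n\<^sup>1\<^sup>/\<^sup>2\<close> for every process
  (\<open>visits_second_moment\<close>); if it does not, then two empirical conditional probabilities differ by a
  fixed amount in the limit, by Birkhoff's theorem (\<open>birkhoff\<close>). A threshold between the two
  scales yields a consistent test (\<open>accepts_node_consistent\<close>). The strings that pass need not be the
  nodes of any irreducible tree; the estimator is an irreducible tree that agrees with the tests on
  all strings up to the largest possible length. As the context tree is itself irreducible
  (\<open>context_tree_irreducible\<close>), the estimate is right wherever the tests are.

  If the weights are not summable, no estimator works. Drive a process by i.i.d. instructions: emit a
  given symbol, or copy the symbol emitted \<open>k + 1\<close> steps earlier provided that \<open>k\<close> lies in a set \<open>S\<close>,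
  and otherwise emit a fixed symbol. These processes are factors of an i.i.d. sequence and therefore
  ergodic. For finite \<open>S\<close> the memory is bounded and the tree is finite, so a consistent estimate
  has finite weight with high probability at large sample sizes; for infinite \<open>S\<close> every string is a
  node (\<open>nodes_infinite_memory\<close>), so a consistent estimate has infinite weight with high probability. But
  the law of a sample of fixed size depends almost only on a finite part of \<open>S\<close>: adding elements one
  at a time, each so large that it hardly affects a sample of the size at which the current finite
  set is recognised as such, gives an infinite \<open>S\<close> that keeps looking finite at arbitrarily large
  sample sizes (\<open>not_estimable\<close>).
\<close>

section \<open>The pointwise ergodic theorem\<close>

definition orbit_sum :: "('w \<Rightarrow> 'w) \<Rightarrow> ('w \<Rightarrow> real) \<Rightarrow> nat \<Rightarrow> 'w \<Rightarrow> real" where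
  "orbit_sum T f n x = (\<Sum>i<n. f ((T ^^ i) x))"

text \<open>
  The maximum of the orbit sums of lengths \<open>0, \<dots>, n\<close>; this recursion, rather than a maximum
  over an index set, is the form in which the maximal inequality uses it.
\<close>

primrec max_orbit_sum :: "('w \<Rightarrow> 'w) \<Rightarrow> ('w \<Rightarrow> real) \<Rightarrow> nat \<Rightarrow> 'w \<Rightarrow> real" where
  "max_orbit_sum T f 0 x = 0"
| "max_orbit_sum T f (Suc n) x = max 0 (f x + max_orbit_sum T f n (T x))"

lemma orbit_sum_Suc: "orbit_sum T f (Suc n) x = f x + orbit_sum T f n (T x)"
  unfolding orbit_sum_def by (subst sum.lessThan_Suc_shift) (simp add: funpow_swap1)

lemma max_orbit_sum_nonneg: "max_orbit_sum T f n x \<ge> 0"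
  by (cases n) auto

lemma max_orbit_sum_Suc_le: "max_orbit_sum T f n x \<le> max_orbit_sum T f (Suc n) x"
  by (induction n arbitrary: x) (auto simp: max.coboundedI2 max.mono add_left_mono)

lemma max_orbit_sum_mono: "m \<le> n \<Longrightarrow> max_orbit_sum T f m x \<le> max_orbit_sum T f n x"
  by (rule lift_Suc_mono_le[of "\<lambda>n. max_orbit_sum T f n x"]) (rule max_orbit_sum_Suc_le)

lemma orbit_sum_le_max: "orbit_sum T f n x \<le> max_orbit_sum T f n x"
proof (induction n arbitrary: x)
  case 0
  then show ?case by (simp add: orbit_sum_def)
next
  case (Suc n)
  have "orbit_sum T f (Suc n) x \<le> f x + max_orbit_sum T f n (T x)"
    using Suc[of "T x"] by (simp add: orbit_sum_Suc)
  then show ?case by simp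
qed

locale ergodic_map = prob_space M for M :: "'w measure" +
  fixes T :: "'w \<Rightarrow> 'w"
  assumes map_measurable [measurable]: "T \<in> M \<rightarrow>\<^sub>M M"
    and map_invariant: "distr M M T = M"
    and invariant_trivial:
      "\<And>E. E \<in> sets M \<Longrightarrow> T -` E \<inter> space M = E \<Longrightarrow> prob E = 0 \<or> prob E = 1"
begin

lemma max_orbit_sum_measurable [measurable]:
  assumes [measurable]: "f \<in> borel_measurable M"
  shows "max_orbit_sum T f n \<in> borel_measurable M"
  by (induction n) auto

lemma max_orbit_sum_le:
  assumes "\<And>x. \<bar>f x\<bar> \<le> B"
  shows "max_orbit_sum T f n x \<le> real n * B"
proof (induction n arbitrary: x)
  case (Suc n)
  have "f x \<le> B" using assms[of x] by simp
  moreover have "0 \<le> B" using assms[of x] by simp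
  ultimately show ?case using Suc[of "T x"] by (simp add: algebra_simps)
qed simp

lemma max_orbit_sum_integrable:
  assumes "f \<in> borel_measurable M" "\<And>x. \<bar>f x\<bar> \<le> B"
  shows "integrable M (max_orbit_sum T f n)"
proof (rule integrable_const_bound[where B = "real n * B"])
  show "AE x in M. norm (max_orbit_sum T f n x) \<le> real n * B"
    using max_orbit_sum_le[of f B n, OF assms(2)] by (simp add: max_orbit_sum_nonneg)
qed (use assms(1) in measurable)

text \<open>
  Garsia's argument: write \<open>m\<close> for the maximum over lengths up to \<open>n + 1\<close>. Where \<open>m\<close> is positive,
  it is \<open>f\<close> plus a maximum at the next point that is at most \<open>m \<circ> T\<close>; elsewhere \<open>m = 0 \<le> m \<circ> T\<close>. So the
  integrand dominates \<open>m - m \<circ> T\<close>, whose integral vanishes by invariance.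
\<close>

lemma maximal_ergodic:
  assumes f: "f \<in> borel_measurable M" "\<And>x. \<bar>f x\<bar> \<le> B"
  shows "(\<integral>x. f x * indicator {x. max_orbit_sum T f (Suc n) x > 0} x \<partial>M) \<ge> 0"
proof -
  let ?m = "max_orbit_sum T f (Suc n)"
  note [measurable] = f(1)
  have int: "integrable M ?m" by (rule max_orbit_sum_integrable[OF f])
  have eq: "(\<integral>x. ?m (T x) \<partial>M) = (\<integral>x. ?m x \<partial>M)"
    using integral_distr[of T M M ?m] by (simp add: map_invariant del: max_orbit_sum.simps)
  have intT: "integrable M (\<lambda>x. ?m (T x))"
    by (rule integrable_distr[OF map_measurable]) (simp add: map_invariant int del: max_orbit_sum.simps)
  have "(\<integral>x. ?m x - ?m (T x) \<partial>M) \<le> (\<integral>x. f x * indicator {x. ?m x > 0} x \<partial>M)"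
  proof (rule integral_mono)
    show "integrable M (\<lambda>x. ?m x - ?m (T x))" by (rule Bochner_Integration.integrable_diff[OF int intT])
    have "{x \<in> space M. ?m x > 0} \<in> sets M" by measurable
    then show "integrable M (\<lambda>x. f x * indicator {x. ?m x > 0} x)"
      using f by (intro integrable_const_bound[where B = B])
        (auto simp: indicator_def abs_mult simp del: max_orbit_sum.simps
              intro: order_trans[OF abs_ge_zero f(2)])
    show "?m x - ?m (T x) \<le> f x * indicator {x. ?m x > 0} x" for x
      using max_orbit_sum_Suc_le[of T f n "T x"] max_orbit_sum_nonneg[of T f "Suc n" "T x"]
      by (cases "?m x > 0") (auto simp: max_def split: if_splits)
  qed
  then show ?thesis
    using Bochner_Integration.integral_diff[OF int intT] eq by linarith
qed

text \<open>
  Unboundedness of the orbit sums is an invariant event. If it had probability one, the sets in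
  the maximal inequality would exhaust the space, and in the limit the inequality would contradict
  the negative mean.
\<close>

lemma orbit_sums_bdd_above:
  assumes f: "f \<in> borel_measurable M" "\<And>x. \<bar>f x\<bar> \<le> B" and neg: "(\<integral>x. f x \<partial>M) < 0"
  shows "AE x in M. \<exists>K. \<forall>n. orbit_sum T f n x \<le> K"
proof -
  note [measurable] = f(1)
  define E where "E = {x \<in> space M. \<forall>k::nat. \<exists>n. max_orbit_sum T f n x > real k}"
  have E: "E \<in> sets M" unfolding E_def by measurable
  have inv: "T -` E \<inter> space M = E"
  proof (intro set_eqI iffI)
    fix x assume x: "x \<in> T -` E \<inter> space M"
    have "\<exists>n. max_orbit_sum T f n x > real k" for k
    proof -
      obtain n where "max_orbit_sum T f n (T x) > real (k + nat \<lceil>B\<rceil>)"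
        using x unfolding E_def by blast
      then have "f x + max_orbit_sum T f n (T x) > real k"
        using f(2)[of x] by linarith
      then have "max_orbit_sum T f (Suc n) x > real k" by simp
      then show ?thesis ..
    qed
    then show "x \<in> E" using x by (auto simp: E_def)
  next
    fix x assume x: "x \<in> E"
    then have sp: "x \<in> space M" by (simp add: E_def)
    have "\<exists>n. max_orbit_sum T f n (T x) > real k" for k
    proof -
      obtain n where n: "max_orbit_sum T f n x > real (k + nat \<lceil>B\<rceil>)"
        using x unfolding E_def by blast
      then obtain m where m: "n = Suc m" by (cases n) auto
      have "max_orbit_sum T f m (T x) > real k"
        using n f(2)[of x] unfolding m by (auto simp: max_def split: if_splits) linarith+
      then show ?thesis ..
    qed
    then show "x \<in> T -` E \<inter> space M"
      using sp measurable_space[OF map_measurable sp] by (auto simp: E_def)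
  qed
  have "prob E \<noteq> 1"
  proof
    assume "prob E = 1"
    then have "AE x in M. x \<in> E" using E by (simp add: prob_eq_1)
    then have lim: "AE x in M. (\<lambda>n. f x * indicator {x. max_orbit_sum T f (Suc n) x > 0} x) \<longlonglongrightarrow> f x"
    proof (eventually_elim)
      fix x assume "x \<in> E"
      then obtain n0 where n0: "max_orbit_sum T f n0 x > real 0" unfolding E_def by blast
      have "eventually (\<lambda>n. f x * indicator {x. max_orbit_sum T f (Suc n) x > 0} x = f x) sequentially"
        unfolding eventually_sequentially
      proof (intro exI allI impI)
        fix n assume "n0 \<le> n"
        then have "max_orbit_sum T f (Suc n) x > 0"
          using n0 max_orbit_sum_mono[of n0 "Suc n" T f x] by linarith
        then show "f x * indicator {x. max_orbit_sum T f (Suc n) x > 0} x = f x" by simp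
      qed
      then show "(\<lambda>n. f x * indicator {x. max_orbit_sum T f (Suc n) x > 0} x) \<longlonglongrightarrow> f x"
        by (rule tendsto_eventually)
    qed
    have meas: "{x \<in> space M. max_orbit_sum T f (Suc n) x > 0} \<in> sets M" for n by measurable
    have "(\<lambda>n. \<integral>x. f x * indicator {x. max_orbit_sum T f (Suc n) x > 0} x \<partial>M) \<longlonglongrightarrow> (\<integral>x. f x \<partial>M)"
    proof (rule integral_dominated_convergence[OF _ _ _ lim])
      show "integrable M (\<lambda>x. B)" by simp
      show "AE x in M. norm (f x * indicator {x. max_orbit_sum T f (Suc n) x > 0} x) \<le> B" for n
        using f(2) by (auto simp: indicator_def simp del: max_orbit_sum.simps
            intro: order_trans[OF abs_ge_zero f(2)])
    qed (use meas in measurable)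
    then have "(\<integral>x. f x \<partial>M) \<ge> 0"
      by (rule LIMSEQ_le_const) (use maximal_ergodic[OF f] in auto)
    then show False using neg by simp
  qed
  then have "prob E = 0" using invariant_trivial[OF E inv] by simp
  then have "AE x in M. x \<notin> E" using E by (simp add: prob_eq_0)
  with AE_space show ?thesis
  proof eventually_elim
    fix x assume "x \<in> space M" "x \<notin> E"
    then obtain k :: nat where "\<And>n. max_orbit_sum T f n x \<le> real k"
      unfolding E_def by (auto simp: not_less)
    then show "\<exists>K. \<forall>n. orbit_sum T f n x \<le> K"
      by (intro exI[of _ "real k"] allI order_trans[OF orbit_sum_le_max])
  qed
qed

text \<open>
  The previous lemma is applied to \<open>f\<close> minus a constant slightly above its mean. Of the slack
  \<open>2 / (m + 1)\<close>, one half makes the mean negative and the other absorbs the bound on the sums after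
  division by \<open>n\<close>.
\<close>

lemma orbit_average_limsup:
  assumes f: "f \<in> borel_measurable M" "\<And>x. \<bar>f x\<bar> \<le> B"
  shows "AE x in M. \<forall>m. eventually (\<lambda>n. orbit_sum T f n x / real n
           < (\<integral>x. f x \<partial>M) + 2 / real (Suc m)) sequentially"
  unfolding AE_all_countable
proof
  fix m
  define c where "c = (\<integral>x. f x \<partial>M) + 1 / real (Suc m)"
  note [measurable] = f(1)
  have int: "integrable M f"
    by (rule integrable_const_bound[where B = B]) (use f in auto)
  have "\<bar>f x - c\<bar> \<le> B + \<bar>c\<bar>" for x using f(2)[of x] by linarith
  moreover have "(\<integral>x. f x - c \<partial>M) < 0"
    using int by (simp add: c_def prob_space)
  ultimately have "AE x in M. \<exists>K. \<forall>n. orbit_sum T (\<lambda>x. f x - c) n x \<le> K"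
    by (intro orbit_sums_bdd_above) auto
  then show "AE x in M. eventually (\<lambda>n. orbit_sum T f n x / real n
           < (\<integral>x. f x \<partial>M) + 2 / real (Suc m)) sequentially"
  proof eventually_elim
    fix x assume "\<exists>K. \<forall>n. orbit_sum T (\<lambda>x. f x - c) n x \<le> K"
    then obtain K where K: "\<And>n. orbit_sum T (\<lambda>x. f x - c) n x \<le> K" by blast
    have "orbit_sum T (\<lambda>x. f x - c) n x = orbit_sum T f n x - real n * c" for n
      by (simp add: orbit_sum_def sum_subtractf)
    then have K': "orbit_sum T f n x \<le> K + real n * c" for n using K[of n] by simp
    have "(\<lambda>n. K / real n) \<longlonglongrightarrow> 0" by (rule lim_const_over_n)
    then have "eventually (\<lambda>n. K / real n < 1 / real (Suc m)) sequentially"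
      by (rule order_tendstoD) simp
    then show "eventually (\<lambda>n. orbit_sum T f n x / real n
           < (\<integral>x. f x \<partial>M) + 2 / real (Suc m)) sequentially"
      using eventually_gt_at_top[of 0]
    proof eventually_elim
      fix n :: nat assume n: "K / real n < 1 / real (Suc m)" "0 < n"
      have "orbit_sum T f n x / real n \<le> (K + real n * c) / real n"
        using K'[of n] by (rule divide_right_mono) simp
      also have "\<dots> = K / real n + c" using n(2) by (simp add: field_simps)
      also have "\<dots> < 1 / real (Suc m) + c" using n(1) by simp
      also have "\<dots> = (\<integral>x. f x \<partial>M) + 2 / real (Suc m)" by (simp add: c_def)
      finally show "orbit_sum T f n x / real n < (\<integral>x. f x \<partial>M) + 2 / real (Suc m)" .
    qed
  qed
qed

theorem birkhoff:
  assumes f: "f \<in> borel_measurable M" "\<And>x. \<bar>f x\<bar> \<le> B"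
  shows "AE x in M. (\<lambda>n. orbit_sum T f n x / real n) \<longlonglongrightarrow> (\<integral>x. f x \<partial>M)"
proof -
  have "AE x in M. \<forall>m. eventually (\<lambda>n. orbit_sum T (\<lambda>x. - f x) n x / real n
           < (\<integral>x. - f x \<partial>M) + 2 / real (Suc m)) sequentially"
    by (rule orbit_average_limsup) (use f in auto)
  with orbit_average_limsup[OF f] show ?thesis
  proof eventually_elim
    fix x
    assume up: "\<forall>m. eventually (\<lambda>n. orbit_sum T f n x / real n
           < (\<integral>x. f x \<partial>M) + 2 / real (Suc m)) sequentially"
      and lo: "\<forall>m. eventually (\<lambda>n. orbit_sum T (\<lambda>x. - f x) n x / real n
           < (\<integral>x. - f x \<partial>M) + 2 / real (Suc m)) sequentially"
    show "(\<lambda>n. orbit_sum T f n x / real n) \<longlonglongrightarrow> (\<integral>x. f x \<partial>M)"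
    proof (rule tendstoI)
      fix e :: real assume "e > 0"
      then obtain m :: nat where m: "inverse (real (Suc m)) < e / 2"
        using reals_Archimedean[of "e / 2"] by auto
      then have m': "2 / real (Suc m) < e" by (simp add: field_simps)
      have neg: "orbit_sum T (\<lambda>x. - f x) n x = - orbit_sum T f n x" for n
        by (simp add: orbit_sum_def sum_negf)
      from up[rule_format, of m] lo[rule_format, of m]
      show "eventually (\<lambda>n. dist (orbit_sum T f n x / real n) (\<integral>x. f x \<partial>M) < e) sequentially"
        by eventually_elim (use m' in \<open>auto simp: dist_real_def neg abs_less_iff\<close>)
    qed
  qed
qed

end

lemma (in prob_space) AE_eventually_imp_prob_tendsto_0:
  assumes meas: "\<And>n. {x \<in> space M. Q n x} \<in> sets M"
    and AE: "AE x in M. eventually (\<lambda>n. \<not> Q n x) sequentially"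
  shows "(\<lambda>n. \<P>(x in M. Q n x)) \<longlonglongrightarrow> 0"
proof -
  have "(\<lambda>n. \<integral>x. indicator {x \<in> space M. Q n x} x \<partial>M) \<longlonglongrightarrow> (\<integral>x. (0::real) \<partial>M)"
  proof (rule integral_dominated_convergence[where w = "\<lambda>x. 1"])
    show "AE x in M. (\<lambda>n. indicator {x \<in> space M. Q n x} x :: real) \<longlonglongrightarrow> 0"
      using AE
    proof eventually_elim
      fix x assume "eventually (\<lambda>n. \<not> Q n x) sequentially"
      then have "eventually (\<lambda>n. indicator {x \<in> space M. Q n x} x = (0::real)) sequentially"
        by eventually_elim simp
      then show "(\<lambda>n. indicator {x \<in> space M. Q n x} x :: real) \<longlonglongrightarrow> 0"
        by (rule tendsto_eventually)
    qed
  qed (use meas in \<open>auto simp: indicator_def\<close>)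
  then show ?thesis using meas by simp
qed

section \<open>String probabilities of stationary ergodic processes\<close>

lemma space_seq_space [simp]: "space seq_space = UNIV"
  by (simp add: seq_space_def space_PiM)

lemma coordinate_measurable [measurable]: "(\<lambda>\<omega>. \<omega> i) \<in> seq_space \<rightarrow>\<^sub>M count_space UNIV"
  unfolding seq_space_def by measurable

lemma finite_window_sets: "{\<omega>. F (map \<omega> L)} \<in> sets (seq_space :: (int \<Rightarrow> 'a::finite) measure)"
proof (induction L arbitrary: F)
  case Nil
  then show ?case using sets.top[of "seq_space :: (int \<Rightarrow> 'a) measure"] by (cases "F []") auto
next
  case (Cons i L)
  have "{\<omega>. F (map \<omega> (i # L))} = (\<Union>a::'a. (\<lambda>\<omega>. \<omega> i) -` {a} \<inter> space seq_space \<inter> {\<omega>. F (a # map \<omega> L)})"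
    by auto
  also have "\<dots> \<in> sets seq_space"
    by (intro sets.finite_UN sets.Int measurable_sets[OF coordinate_measurable] Cons) auto
  finally show ?case .
qed

lemma funpow_left_shift: "(left_shift ^^ k) \<omega> i = \<omega> (i + int k)"
  by (induction k arbitrary: i) (auto simp: left_shift_def algebra_simps)

lemma map_funpow_left_shift: "map ((left_shift ^^ k) \<omega>) L = map \<omega> (map (\<lambda>i. i + int k) L)"
  by (simp add: funpow_left_shift)

lemma map_add_upto: "map (\<lambda>i. i + k) [a..b] = [a + k..b + k :: int]"
  by (rule nth_equalityI) (auto simp: nth_upto)

lemma past_is_shift:
  "past_is s ((left_shift ^^ k) \<omega>) \<longleftrightarrow> map \<omega> [int k - int (length s)..int k - 1] = s"
  unfolding past_is_def map_funpow_left_shift map_add_upto by (simp add: algebra_simps)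

lemma past_is_Cons: "past_is (a # s) \<omega> \<longleftrightarrow> \<omega> (- int (length s) - 1) = a \<and> past_is s \<omega>"
proof -
  have "[- int (length (a # s))..- 1] = (- int (length s) - 1) # [- int (length s)..- 1]"
    by (subst upto_rec1) auto
  then show ?thesis unfolding past_is_def by (simp del: upto.simps)
qed

text \<open>
  The present symbol becomes the most recent past symbol after one shift; by stationarity, this
  turns joint probabilities of the past and the present into string probabilities.
\<close>

lemma past_is_snoc_shift: "past_is (s @ [a]) (left_shift \<omega>) \<longleftrightarrow> past_is s \<omega> \<and> \<omega> 0 = a"
proof -
  have "past_is (s @ [a]) (left_shift \<omega>) \<longleftrightarrow> map \<omega> [- int (length s)..0] = s @ [a]"
    using past_is_shift[of "s @ [a]" 1 \<omega>] by simp
  also have "[- int (length s)..0] = [- int (length s)..-1] @ [0]"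
    by (subst upto_rec2) auto
  finally show ?thesis by (auto simp: past_is_def)
qed

lemma past_is_suffix: "suffix u v \<Longrightarrow> past_is v \<omega> \<Longrightarrow> past_is u \<omega>"
  unfolding suffix_def by (erule exE) (induct v arbitrary: u, auto simp: Cons_eq_append_conv past_is_Cons)

lemma past_is_Nil [simp]: "past_is [] \<omega>"
  by (simp add: past_is_def)

locale ergodic_process =
  fixes P :: "(int \<Rightarrow> 'a::finite) measure"
  assumes stationary_ergodic: "P \<in> stationary_ergodic"
begin

lemma sets_P [measurable_cong]: "sets P = sets seq_space"
  using stationary_ergodic by (simp add: stationary_ergodic_def)

lemma space_P [simp]: "space P = UNIV"
  using sets_eq_imp_space_eq[OF sets_P] by simp

sublocale ergodic_map P left_shift
proof -
  interpret prob_space P using stationary_ergodic by (simp add: stationary_ergodic_def)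
  have "left_shift \<in> seq_space \<rightarrow>\<^sub>M (seq_space :: (int \<Rightarrow> 'a) measure)"
    unfolding seq_space_def by (rule measurable_PiM_single') (auto simp: left_shift_def)
  then have "left_shift \<in> P \<rightarrow>\<^sub>M P" by (simp add: measurable_cong_sets[OF sets_P sets_P])
  then show "ergodic_map P left_shift"
    by unfold_locales (use stationary_ergodic in \<open>auto simp: stationary_ergodic_def\<close>)
qed

lemma window_event [simp, intro]: "{\<omega>. F (map \<omega> L)} \<in> events"
  by (simp add: sets_P finite_window_sets)

lemma past_event [simp, intro]: "{\<omega>. past_is s \<omega>} \<in> events"
  unfolding past_is_def by (rule window_event)

lemma prob_shift: "{\<omega>. Q \<omega>} \<in> events \<Longrightarrow> prob {\<omega>. Q ((left_shift ^^ k) \<omega>)} = prob {\<omega>. Q \<omega>}"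
proof (induction k)
  case (Suc k)
  have [measurable]: "(left_shift ^^ k) \<in> P \<rightarrow>\<^sub>M P" by (rule measurable_compose_n) (rule map_measurable)
  have meas: "(left_shift ^^ k) -` {\<omega>. Q \<omega>} \<inter> space P \<in> events"
    using Suc(2) by measurable
  have "prob {\<omega>. Q ((left_shift ^^ Suc k) \<omega>)} = measure (distr P P left_shift) {\<omega>. Q ((left_shift ^^ k) \<omega>)}"
    using meas by (subst measure_distr[OF map_measurable]) (auto simp: vimage_def funpow_swap1)
  then show ?case using Suc by (simp add: map_invariant)
qed simp

lemma string_prob_eq: "string_prob P s = prob {\<omega>. past_is s \<omega>}"
  by (simp add: string_prob_def)

lemma string_prob_nonneg [simp]: "string_prob P s \<ge> 0"
  by (simp add: string_prob_def)

lemma string_prob_Nil [simp]: "string_prob P [] = 1"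
  using prob_space by (simp add: string_prob_eq)

lemma string_prob_at: "string_prob P x = prob {\<omega>. past_is x ((left_shift ^^ k) \<omega>)}"
  unfolding string_prob_eq by (rule prob_shift[symmetric]) simp

lemma string_prob_sample: "string_prob P x = prob {\<omega>. map \<omega> [1..int (length x)] = x}"
  unfolding string_prob_at[of x "Suc (length x)"] past_is_shift by simp

text \<open>
  Events about a sample are finite sums of string probabilities, which makes moments of sample
  statistics accessible to induction on the sample size.
\<close>

lemma prob_sample:
  "prob {\<omega>. F (map \<omega> [1..int n])} = (\<Sum>x | length x = n \<and> F x. string_prob P x)"
proof -
  have fin: "finite {x :: 'a list. length x = n \<and> F x}"
    by (rule finite_subset[OF _ finite_lists_length_eq[of UNIV n]]) auto
  have "{\<omega>. F (map \<omega> [1..int n])} = (\<Union>x\<in>{x. length x = n \<and> F x}. {\<omega>. map \<omega> [1..int n] = x})"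
    by auto
  also have "prob \<dots> = (\<Sum>x | length x = n \<and> F x. prob {\<omega>. map \<omega> [1..int n] = x})"
    by (rule finite_measure_finite_Union[OF fin]) (auto simp: disjoint_family_on_def)
  also have "\<dots> = (\<Sum>x | length x = n \<and> F x. string_prob P x)"
    by (rule sum.cong) (auto simp: string_prob_sample)
  finally show ?thesis .
qed

lemma string_prob_snoc: "string_prob P (s @ [a]) = prob {\<omega>. past_is s \<omega> \<and> \<omega> 0 = a}"
  unfolding string_prob_at[of "s @ [a]" 1] by (simp add: past_is_snoc_shift)

lemma snoc_event: "{\<omega>. past_is s \<omega> \<and> \<omega> 0 = a} \<in> events"
proof -
  have "{\<omega>. past_is s \<omega> \<and> \<omega> 0 = a} = {\<omega>. map \<omega> ([- int (length s)..-1] @ [0]) = s @ [a]}"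
    by (auto simp: past_is_def)
  also have "\<dots> \<in> events" by (rule window_event)
  finally show ?thesis .
qed

lemma prob_split_symbol:
  assumes "{\<omega>. Q \<omega>} \<in> events" "\<And>a. {\<omega>. Q \<omega> \<and> \<omega> i = a} \<in> events"
  shows "prob {\<omega>. Q \<omega>} = (\<Sum>a\<in>UNIV. prob {\<omega>. Q \<omega> \<and> \<omega> i = a})"
proof -
  have "{\<omega>. Q \<omega>} = (\<Union>a\<in>UNIV. {\<omega>. Q \<omega> \<and> \<omega> i = a})" by auto
  also have "prob \<dots> = (\<Sum>a\<in>UNIV. prob {\<omega>. Q \<omega> \<and> \<omega> i = a})"
    by (rule finite_measure_finite_Union) (use assms in \<open>auto simp: disjoint_family_on_def\<close>)
  finally show ?thesis .
qed

lemma sum_string_prob_snoc: "(\<Sum>a\<in>UNIV. string_prob P (s @ [a])) = string_prob P s"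
  unfolding string_prob_snoc unfolding string_prob_eq
  by (rule prob_split_symbol[symmetric]) (auto intro: snoc_event)

lemma sum_string_prob_Cons: "(\<Sum>a\<in>UNIV. string_prob P (a # s)) = string_prob P s"
proof -
  have eq: "string_prob P (a # s) = prob {\<omega>. past_is s \<omega> \<and> \<omega> (- int (length s) - 1) = a}" for a
    unfolding string_prob_eq past_is_Cons by (simp add: conj_commute)
  have "{\<omega>. past_is s \<omega> \<and> \<omega> (- int (length s) - 1) = a} \<in> events" for a
    using past_event[of "a # s"] unfolding past_is_Cons by (simp add: conj_commute)
  then show ?thesis unfolding eq unfolding string_prob_eq
    by (intro prob_split_symbol[symmetric]) auto
qed

lemma string_prob_suffix: "suffix u v \<Longrightarrow> string_prob P v \<le> string_prob P u"
  unfolding string_prob_eq by (rule finite_measure_mono) (auto intro: past_is_suffix)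

lemma string_prob_prefix_0: "string_prob P s = 0 \<Longrightarrow> string_prob P (s @ [a]) = 0"
  using sum_string_prob_snoc[of s] sum_nonneg_eq_0_iff[of UNIV "\<lambda>a. string_prob P (s @ [a])"] by auto

lemma next_prob_eq: "next_prob P a s = string_prob P (s @ [a]) / string_prob P s"
  unfolding next_prob_def cond_prob_def string_prob_snoc unfolding string_prob_eq by (simp add: conj_commute)

lemma string_prob_snoc_next: "string_prob P (s @ [a]) = next_prob P a s * string_prob P s"
  using string_prob_prefix_0[of s a] by (cases "string_prob P s = 0") (auto simp: next_prob_eq)

end

section \<open>Nodes and irreducibility of the context tree\<close>

lemma is_suffix_LInf_iff: "is_suffix w (LInf x) \<longleftrightarrow> stake (length w) x = rev w"
proof
  assume "stake (length w) x = rev w"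
  then have "x = rev w @- sdrop (length w) x" by (metis stake_sdrop)
  then show "is_suffix w (LInf x)" by auto
qed (auto simp: stake_shift)

lemma is_suffix_trans: "suffix u v \<Longrightarrow> is_suffix v s \<Longrightarrow> is_suffix u s"
  by (cases s) (auto simp: suffix_def intro: suffix_order.trans)

lemma is_suffix_comparable:
  assumes "is_suffix u s" "is_suffix v s" "length u \<le> length v"
  shows "suffix u v"
proof (cases s)
  case (Fin t)
  then show ?thesis using assms suffix_length_suffix by auto
next
  case (LInf x)
  then have "stake (length u) x = rev u" "stake (length v) x = rev v"
    using assms by (auto simp: is_suffix_LInf_iff simp del: is_suffix.simps)
  then have "rev u = take (length u) (rev v)"
    using assms(3) by (metis min.absorb1 take_stake)
  then have "prefix (rev u) (rev v)" by (metis take_is_prefix)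
  then show ?thesis by (simp add: suffix_to_prefix)
qed

lemma is_proper_suffix_iff: "is_proper_suffix u s \<longleftrightarrow> is_suffix u s \<and> s \<noteq> Fin u"
  by (cases s) (auto simp: strict_suffix_def)

lemma strict_suffix_imp_is_proper_suffix:
  assumes "strict_suffix u v" "is_suffix v s"
  shows "is_proper_suffix u s"
proof -
  have "s \<noteq> Fin u" using assms by (auto simp: strict_suffix_def dest: suffix_order.antisym)
  then show ?thesis using is_suffix_trans[of u v s] assms
    by (simp add: is_proper_suffix_iff suffix_order.less_imp_le)
qed

lemma strict_suffix_Cons_iff: "strict_suffix u (a # v) \<longleftrightarrow> suffix u v"
  by (auto simp: strict_suffix_def suffix_Cons dest: suffix_length_le)

context ergodic_process
begin

text \<open>
  The nodes of the context tree, described by conditions on the string alone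
  (\<open>nodes_context_tree\<close>).
\<close>

definition node :: "'a list \<Rightarrow> bool" where
  "node v \<longleftrightarrow> string_prob P v > 0 \<and> (\<forall>u. strict_suffix u v \<longrightarrow> \<not> determines_next P u)"

lemma ex_positive_extension:
  assumes "string_prob P v > 0" shows "\<exists>a. string_prob P (a # v) > 0"
proof (rule ccontr)
  assume "\<not> ?thesis"
  then have "string_prob P (a # v) = 0" for a 
    using string_prob_nonneg[of "a # v"] by (metis less_eq_real_def)
  then show False using sum_string_prob_Cons[of v] assms by simp
qed

lemma positive_suffix: "suffix u v \<Longrightarrow> string_prob P v > 0 \<Longrightarrow> string_prob P u > 0"
  using string_prob_suffix[of u v] by linarith

lemma node_suffix: "node v \<Longrightarrow> suffix u v \<Longrightarrow> node u"
  unfolding node_def using positive_suffix suffix_order.less_le_trans by metis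

lemma is_context_iff: "is_context P s \<longleftrightarrow> node s \<and> determines_next P s"
  unfolding is_context_def node_def by auto

lemma ex_determining_imp_context_suffix:
  "determines_next P s \<Longrightarrow> string_prob P s > 0 \<Longrightarrow> \<exists>u. suffix u s \<and> is_context P u"
proof (induction "length s" arbitrary: s rule: less_induct)
  case less
  show ?case
  proof (cases "\<exists>u. strict_suffix u s \<and> determines_next P u")
    case True
    then obtain u where u: "strict_suffix u s" "determines_next P u" by blast
    then show ?thesis
      using less(1)[of u] positive_suffix[of u s] less(3)
      by (meson suffix_length_less suffix_order.less_imp_le suffix_order.trans)
  next
    case False
    then show ?thesis using less by (auto simp: is_context_def)
  qed
qed

lemma leaf_suffix_is_node:
  assumes "s \<in> context_tree P" "is_suffix u s" shows "node u"
proof (cases s)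
  case (Fin t)
  then show ?thesis using assms node_suffix by (auto simp: context_tree_def is_context_iff)
next
  case (LInf x)
  then have inf: "is_infinite_context P x" using assms by (auto simp: context_tree_def)
  have "\<not> determines_next P v" if "suffix v u" for v
    using ex_determining_imp_context_suffix[of v] inf assms(2) that
      is_suffix_trans unfolding is_infinite_context_def LInf by blast
  then show ?thesis using inf assms(2)
    unfolding is_infinite_context_def LInf node_def
    by (simp add: suffix_order.less_imp_le del: is_suffix.simps)
qed

text \<open>
  If some extension of \<open>v\<close> of positive probability determines the next symbol, then it has a context
  as a suffix, and this context extends \<open>v\<close>. Otherwise \<open>v\<close> can be extended to the left forever through
  strings of positive probability, and the limit is an infinite context.
\<close>

lemma node_extends_to_leaf:
  assumes "node v" shows "\<exists>s\<in>context_tree P. is_suffix v s"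
proof (cases "\<exists>w. suffix v w \<and> string_prob P w > 0 \<and> determines_next P w")
  case True
  then obtain w where w: "suffix v w" "string_prob P w > 0" "determines_next P w" by blast
  then obtain u where u: "suffix u w" "is_context P u"
    using ex_determining_imp_context_suffix by blast
  have "suffix v u"
  proof (rule ccontr)
    assume "\<not> suffix v u"
    then have "strict_suffix u v"
      using suffix_same_cases[OF u(1) w(1)] by (auto simp: strict_suffix_def)
    then show False using assms u(2) by (auto simp: node_def is_context_iff)
  qed
  moreover have "Fin u \<in> context_tree P" using u(2) by (simp add: context_tree_def)
  ultimately show ?thesis by (intro bexI[of _ "Fin u"]) auto
next
  case False
  define g where "g u = (SOME a. string_prob P (a # u) > 0)" for u
  have g: "string_prob P (g u # u) > 0" if "string_prob P u > 0" for u
    unfolding g_def by (rule someI_ex) (rule ex_positive_extension[OF that])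
  define h where "h u = g u # u" for u
  define x where "x = rev v @- smap g (siterate h v)"
  have pos: "string_prob P ((h ^^ n) v) > 0" for n
    by (induction n) (use assms g in \<open>auto simp: node_def h_def\<close>)
  have x: "x = rev ((h ^^ n) v) @- smap g (siterate h ((h ^^ n) v))" for n
  proof (induction n)
    case (Suc n)
    define y where "y = (h ^^ n) v"
    have "x = rev y @- smap g (siterate h y)" using Suc by (simp add: y_def)
    also have "smap g (siterate h y) = g y ## smap g (siterate h (h y))"
      by (subst siterate.code) simp
    also have "rev y @- \<dots> = rev (h y) @- smap g (siterate h (h y))"
      by (simp add: h_def[of y])
    finally show ?case by (simp add: y_def)
  qed (simp add: x_def)
  have ext: "suffix v ((h ^^ n) v)" for n
    by (induction n) (auto simp: h_def suffix_Cons)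
  have len: "length ((h ^^ n) v) = n + length v" for n
    by (induction n) (auto simp: h_def)
  have "is_infinite_context P x"
    unfolding is_infinite_context_def
  proof (intro allI impI conjI)
    fix w assume w: "is_suffix w (LInf x)"
    define y where "y = (h ^^ length w) v"
    have "is_suffix y (LInf x)" unfolding y_def using x[of "length w"] by auto
    then have wy: "suffix w y"
      by (rule is_suffix_comparable[OF w]) (simp add: y_def len)
    then show wpos: "string_prob P w > 0" using positive_suffix pos[of "length w"] by (simp add: y_def)
    show "\<not> is_context P w"
    proof
      assume c: "is_context P w"
      have "suffix v w"
      proof (rule ccontr)
        assume "\<not> suffix v w"
        then have "strict_suffix w v"
          using suffix_same_cases[OF wy ext[of "length w", folded y_def]] by (auto simp: strict_suffix_def)
        then show False using assms c by (auto simp: node_def is_context_iff)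
      qed
      then show False using False wpos c by (auto simp: is_context_iff)
    qed
  qed
  then have "LInf x \<in> context_tree P" by (auto simp: context_tree_def)
  moreover have "is_suffix v (LInf x)" by (auto simp: x_def)
  ultimately show ?thesis by blast
qed

theorem nodes_context_tree: "nodes (context_tree P) = {v. node v}"
  unfolding nodes_def using leaf_suffix_is_node node_extends_to_leaf by auto

lemma Fin_leaf: "Fin w \<in> context_tree P \<longleftrightarrow> is_context P w"
  by (auto simp: context_tree_def)

lemma proper_suffix_of_leaf_not_determining:
  assumes "s \<in> context_tree P" "is_proper_suffix u s" shows "\<not> determines_next P u"
proof
  assume det: "determines_next P u"
  have suf: "is_suffix u s" "s \<noteq> Fin u" using assms(2) by (auto simp: is_proper_suffix_iff)
  have node: "node u" using leaf_suffix_is_node[OF assms(1) suf(1)] .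
  then have c: "is_context P u" using det by (simp add: is_context_iff)
  show False
  proof (cases s)
    case (Fin t)
    then show False using assms det by (auto simp: Fin_leaf is_context_def)
  next
    case (LInf x)
    then have "is_infinite_context P x" using assms by (auto simp: context_tree_def)
    then show False using c suf(1) unfolding LInf is_infinite_context_def by blast
  qed
qed

text \<open>
  The two pasts agree up to a null set.
\<close>

lemma next_prob_eq_if_same_prob:
  assumes "suffix u v" "string_prob P v = string_prob P u"
  shows "next_prob P a v = next_prob P a u"
proof -
  have le: "string_prob P (v @ [b]) \<le> string_prob P (u @ [b])" for b
    using assms(1) by (intro string_prob_suffix) (auto simp: suffix_def)
  have "string_prob P (v @ [a]) = string_prob P (u @ [a])"
  proof (rule ccontr)
    assume "string_prob P (v @ [a]) \<noteq> string_prob P (u @ [a])"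
    with le[of a] have lt: "string_prob P (v @ [a]) < string_prob P (u @ [a])" by linarith
    have "(\<Sum>b\<in>UNIV. string_prob P (v @ [b])) < (\<Sum>b\<in>UNIV. string_prob P (u @ [b]))"
      by (rule sum_strict_mono_ex1) (use le lt in auto)
    then show False using assms(2) by (simp add: sum_string_prob_snoc)
  qed
  then show ?thesis using assms(2) by (simp add: next_prob_eq)
qed

text \<open>
  Suppose that \<open>s\<close> were the only leaf beyond \<open>u\<close>. Then every string of positive probability that
  extends \<open>u\<close> lies on the branch towards \<open>s\<close> or beyond \<open>s\<close>. On the branch the probability never
  drops, so the next-symbol probabilities stay those of \<open>u\<close>; beyond \<open>s\<close> they stay those of the context
  \<open>s\<close>. Hence \<open>u\<close> would determine the next symbol, which no proper suffix of a leaf does.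
\<close>

lemma ex_other_leaf:
  assumes "s \<in> context_tree P" "is_proper_suffix u s"
  shows "\<exists>s'\<in>context_tree P. s' \<noteq> s \<and> is_proper_suffix u s'"
proof (rule ccontr)
  assume only: "\<not> ?thesis"
  have us: "is_suffix u s" using assms(2) by (simp add: is_proper_suffix_iff)
  have inv: "(is_suffix v s \<and> string_prob P v = string_prob P u) \<or> (\<exists>t. s = Fin t \<and> suffix t v \<and> string_prob P t = string_prob P u)"
    if "string_prob P v > 0" "suffix u v" for v
    using that
  proof (induction v)
    case Nil
    then show ?case using us by simp
  next
    case (Cons c v)
    show ?case
    proof (cases "suffix u v")
      case False
      then have "u = c # v" using Cons.prems(2) by (auto simp: suffix_Cons)
      then show ?thesis using us by simp
    next
      case True
      have vpos: "string_prob P v > 0"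
        using positive_suffix[OF _ Cons.prems(1)] by (simp add: suffix_Cons)
      show ?thesis
      proof (cases "\<exists>t. s = Fin t \<and> suffix t v")
        case True
        then obtain t where t: "s = Fin t" "suffix t v" by blast
        moreover have "string_prob P t = string_prob P u"
          using Cons.IH[OF vpos \<open>suffix u v\<close>] t by (auto dest: suffix_order.antisym)
        ultimately show ?thesis by (auto simp: suffix_Cons)
      next
        case beyond: False
        then have v: "is_suffix v s" "string_prob P v = string_prob P u"
          using Cons.IH[OF vpos True] by auto
        have proper: "is_proper_suffix v s" using v(1) beyond by (auto simp: is_proper_suffix_iff)
        \<comment> \<open>A child of positive probability is a node, and the leaf beyond it extends \<open>u\<close>, so it is \<open>s\<close>.\<close>
        have child: "is_suffix (d # v) s" if "string_prob P (d # v) > 0" for d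
        proof -
          have "\<not> determines_next P w" if "suffix w v" for w
          proof -
            have "is_proper_suffix w s"
              using that v(1) proper strict_suffix_imp_is_proper_suffix[of w v s]
              by (auto simp: strict_suffix_def)
            then show ?thesis using proper_suffix_of_leaf_not_determining assms(1) by blast
          qed
          then have "node (d # v)" using that by (auto simp: node_def strict_suffix_Cons_iff)
          then obtain s' where s': "s' \<in> context_tree P" "is_suffix (d # v) s'"
            using node_extends_to_leaf by blast
          moreover have "is_proper_suffix u s'"
            using s'(2) True by (intro strict_suffix_imp_is_proper_suffix[of u "d # v"]) (simp_all add: strict_suffix_Cons_iff)
          ultimately show ?thesis using only by metis
        qed
        have "string_prob P (d # v) = 0" if "d \<noteq> c" for d
        proof (rule ccontr)
          assume "string_prob P (d # v) \<noteq> 0"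
          then have "is_suffix (d # v) s" using child[of d] string_prob_nonneg[of "d # v"] by linarith
          then have "suffix (d # v) (c # v)"
            using is_suffix_comparable[of "d # v" s "c # v"] child[OF Cons.prems(1)] by simp
          then show False using that by (auto dest: suffix_length_le simp: suffix_Cons)
        qed
        then have "(\<Sum>d\<in>UNIV. string_prob P (d # v)) = (\<Sum>d\<in>UNIV. if d = c then string_prob P (c # v) else 0)"
          by (intro sum.cong) auto
        then have "string_prob P (c # v) = string_prob P v"
          by (simp add: sum_string_prob_Cons)
        then show ?thesis using child[OF Cons.prems(1)] v(2) by simp
      qed
    qed
  qed
  have "determines_next P u"
    unfolding determines_next_def
  proof (intro allI impI)
    fix a v assume v: "string_prob P v > 0" "suffix u v"
    show "next_prob P a v = next_prob P a u"
    proof (cases "is_suffix v s \<and> string_prob P v = string_prob P u")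
      case True
      then show ?thesis using next_prob_eq_if_same_prob v(2) by blast
    next
      case False
      then obtain t where t: "s = Fin t" "suffix t v" "string_prob P t = string_prob P u"
        using inv[OF v] by blast
      then have c: "is_context P t" using assms(1) by (simp add: Fin_leaf)
      have "next_prob P a v = next_prob P a t"
        using c v(1) t(2) by (auto simp: is_context_def determines_next_def)
      then show ?thesis
        using next_prob_eq_if_same_prob[of u t a] us t by simp
    qed
  qed
  then show False using proper_suffix_of_leaf_not_determining[OF assms] by simp
qed

theorem context_tree_irreducible: "context_tree P \<in> irreducible_trees"
proof -
  have "is_tree (context_tree P)"
    unfolding is_tree_def
    using proper_suffix_of_leaf_not_determining by (auto simp: Fin_leaf is_context_iff)
  moreover have "\<not> is_tree (insert (Fin u) (context_tree P - {s}))"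
    if "s \<in> context_tree P" "is_proper_suffix u s" for s u
    using ex_other_leaf[OF that] unfolding is_tree_def by blast
  ultimately show ?thesis by (auto simp: irreducible_trees_def)
qed

end

section \<open>A consistent test for a single node\<close>

text \<open>
  An occurrence at the very end of the sample, with no symbol after it, is not a visit.
\<close>

definition visits :: "'a list \<Rightarrow> 'a list \<Rightarrow> real" where
  "visits w x = (\<Sum>t<length x. of_bool (suffix w (take t x)))"

definition visits_then :: "'a list \<Rightarrow> 'a \<Rightarrow> 'a list \<Rightarrow> real" where
  "visits_then w a x = (\<Sum>t<length x. of_bool (suffix w (take t x) \<and> x ! t = a))"

lemma visits_snoc: "visits w (y @ [b]) = visits w y + of_bool (suffix w y)"
  unfolding visits_def by simp

lemma visits_then_snoc:
  "visits_then w a (y @ [b]) = visits_then w a y + of_bool (suffix w y) * of_bool (b = a)"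
proof -
  have "visits_then w a (y @ [b]) =
      (\<Sum>t<length y. of_bool (suffix w (take t y) \<and> (y @ [b]) ! t = a)) + of_bool (suffix w y \<and> b = a)"
    unfolding visits_then_def by simp
  also have "(\<Sum>t<length y. of_bool (suffix w (take t y) \<and> (y @ [b]) ! t = a)) = visits_then w a y"
    unfolding visits_then_def by (rule sum.cong) (auto simp: nth_append)
  finally show ?thesis by (simp add: of_bool_conj)
qed

lemma visits_bounds: "0 \<le> visits w x" "visits w x \<le> real (length x)"
proof -
  show "0 \<le> visits w x" unfolding visits_def by (rule sum_nonneg) simp
  have "visits w x \<le> (\<Sum>t<length x. 1)" unfolding visits_def by (rule sum_mono) simp
  then show "visits w x \<le> real (length x)" by simp
qed

lemma sum_lists_Suc:
  "(\<Sum>x | length x = Suc n. G x) = (\<Sum>y | length y = n. \<Sum>b\<in>UNIV. G (y @ [b :: 'a::finite]))"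
proof -
  have "(\<Sum>y | length y = n. \<Sum>b\<in>UNIV. G (y @ [b])) = (\<Sum>(y, b)\<in>{y. length y = n} \<times> UNIV. G (y @ [b]))"
    by (subst sum.cartesian_product) simp
  also have "\<dots> = (\<Sum>x | length x = Suc n. G x)"
  proof (rule sum.reindex_bij_witness[where i = "\<lambda>x. (butlast x, last x)" and j = "\<lambda>(y, b). y @ [b]"])
    fix x :: "'a list" assume "x \<in> {x. length x = Suc n}"
    then have "x \<noteq> []" by auto
    then show "(case (butlast x, last x) of (y, b) \<Rightarrow> y @ [b]) = x" by simp
  qed auto
  finally show ?thesis by simp
qed

text \<open>
  The number of strings tested grows, so that each string is eventually tested, but so slowly
  that a union bound over test errors of order \<open>n\<^sup>-\<^sup>1\<^sup>/\<^sup>2\<close> still tends to 0.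
\<close>

definition test_strings :: "nat \<Rightarrow> 'a::countable list set" where
  "test_strings n = {w. real (to_nat w) \<le> real n powr (1/4)}"

text \<open>
  Two empirical conditional probabilities, of \<open>a\<close> after \<open>w\<close> and after \<open>w'\<close>, are compared after
  multiplication with both denominators, which may vanish. If \<open>u\<close> determines the next symbol, the
  difference rarely exceeds order \<open>n \<cdot> n\<^sup>3\<^sup>/\<^sup>4\<close>; a true difference between the conditional probabilities
  is of order \<open>n\<^sup>2\<close>.
\<close>

definition refutes_determining :: "'a::countable list \<Rightarrow> 'a list \<Rightarrow> bool" where
  "refutes_determining x u \<longleftrightarrow> (\<exists>w\<in>test_strings (length x). \<exists>w'\<in>test_strings (length x). \<exists>a.
     suffix u w \<and> suffix u w' \<and>
     \<bar>visits_then w a x * visits w' x - visits_then w' a x * visits w x\<bar> > 2 * real (length x) powr (7/4))"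

definition accepts_node :: "'a::countable list \<Rightarrow> 'a list \<Rightarrow> bool" where
  "accepts_node x v \<longleftrightarrow> visits v x > 0 \<and> (\<forall>u. strict_suffix u v \<longrightarrow> refutes_determining x u)"

lemma finite_card_test_strings:
  "finite (test_strings n :: 'a::countable list set)"
  "real (card (test_strings n :: 'a::countable list set)) \<le> real n powr (1/4) + 1"
proof -
  define m where "m = nat \<lfloor>real n powr (1/4)\<rfloor>"
  have sub: "to_nat ` (test_strings n :: 'a list set) \<subseteq> {..m}"
    by (auto simp: test_strings_def m_def le_nat_floor)
  have inj: "inj_on to_nat (test_strings n :: 'a list set)" by simp
  show "finite (test_strings n :: 'a list set)"
    using finite_imageD[OF finite_subset[OF sub] inj] by simp
  have "card (test_strings n :: 'a list set) \<le> card {..m}"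
    using card_inj_on_le[OF inj sub] by simp
  then have "real (card (test_strings n :: 'a list set)) \<le> real m + 1" by simp
  also have "real m \<le> real n powr (1/4)" by (simp add: m_def of_nat_floor)
  finally show "real (card (test_strings n :: 'a list set)) \<le> real n powr (1/4) + 1" by simp
qed

lemma eventually_test_string: "eventually (\<lambda>n. w \<in> test_strings n) sequentially"
proof -
  have "filterlim (\<lambda>n::nat. real n powr (1/4)) at_top sequentially" by real_asymp
  then show ?thesis
    unfolding test_strings_def filterlim_at_top by simp
qed

lemma length_sample [simp]: "length (map \<omega> [1..int n]) = n"
  by simp

lemma suffix_take_sample:
  assumes "t < n"
  shows "suffix w (take t (map \<omega> [1..int n])) \<longleftrightarrow>
    length w \<le> t \<and> past_is w ((left_shift ^^ Suc t) \<omega>)"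
proof -
  have take: "take t (map \<omega> [1..int n]) = map \<omega> [1..int t]"
    using assms by (intro nth_equalityI) (auto simp: nth_upto)
  show ?thesis
  proof (cases "length w \<le> t")
    case True
    have "[1..int t] = [1..int t - int (length w)] @ [int t - int (length w) + 1..int t]"
      using upto_split1[of 1 "int t - int (length w) + 1" "int t"] True by (cases "w = []") (auto simp: Suc_le_eq)
    then have "suffix w (map \<omega> [1..int t]) \<longleftrightarrow>
        suffix w (map \<omega> [1..int t - int (length w)] @ map \<omega> [int t - int (length w) + 1..int t])"
      by simp
    also have "\<dots> \<longleftrightarrow> map \<omega> [int t - int (length w) + 1..int t] = w"
      by (auto simp: suffix_def append_eq_append_conv)
    finally show ?thesis using True
      unfolding take past_is_shift by (simp add: algebra_simps)
  next
    case False
    then show ?thesis unfolding take by (auto dest: suffix_length_le)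
  qed
qed

lemma visits_sample:
  "visits w (map \<omega> [1..int n]) = (\<Sum>t<n. of_bool (length w \<le> t \<and> past_is w ((left_shift ^^ Suc t) \<omega>)))"
  unfolding visits_def by (rule sum.cong) (auto simp: suffix_take_sample simp del: funpow.simps)

lemma visits_then_sample:
  "visits_then w a (map \<omega> [1..int n]) = (\<Sum>t<n. of_bool (length w \<le> t \<and>
     (past_is w ((left_shift ^^ Suc t) \<omega>) \<and> (left_shift ^^ Suc t) \<omega> 0 = a)))"
  unfolding visits_then_def
  by (rule sum.cong)
     (auto simp: suffix_take_sample nth_upto funpow_left_shift add.commute simp del: funpow.simps)

context ergodic_process
begin

text \<open>
  Birkhoff's theorem for an indicator; the occurrences lost at the start of the sample are bounded
  in number.
\<close>

lemma occurrence_frequency: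
  assumes Q: "{\<omega>. Q \<omega>} \<in> events"
  shows "AE \<omega> in P. (\<lambda>n. (\<Sum>t<n. of_bool (m \<le> t \<and> Q ((left_shift ^^ Suc t) \<omega>))) / real n)
           \<longlonglongrightarrow> prob {\<omega>. Q \<omega>}"
proof -
  let ?f = "indicator {\<omega>. Q \<omega>} :: _ \<Rightarrow> real"
  have "AE \<omega> in P. (\<lambda>n. orbit_sum left_shift ?f n \<omega> / real n) \<longlonglongrightarrow> (\<integral>\<omega>. ?f \<omega> \<partial>P)"
    by (rule birkhoff[where B = 1]) (use Q in \<open>auto simp: indicator_def\<close>)
  then show ?thesis
  proof eventually_elim
    fix \<omega>
    assume lim: "(\<lambda>n. orbit_sum left_shift ?f n \<omega> / real n) \<longlonglongrightarrow> (\<integral>\<omega>. ?f \<omega> \<partial>P)"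
    define S where "S n = (\<Sum>t<n. of_bool (m \<le> t \<and> Q ((left_shift ^^ Suc t) \<omega>)) :: real)" for n
    define R where "R n = (\<Sum>t<n. ?f ((left_shift ^^ Suc t) \<omega>))" for n
    have R: "\<bar>R n - orbit_sum left_shift ?f n \<omega>\<bar> \<le> 1" for n
    proof -
      have "orbit_sum left_shift ?f (Suc n) \<omega> = ?f \<omega> + R n"
        unfolding orbit_sum_def R_def by (subst sum.lessThan_Suc_shift) simp
      moreover have "orbit_sum left_shift ?f (Suc n) \<omega>
          = orbit_sum left_shift ?f n \<omega> + ?f ((left_shift ^^ n) \<omega>)"
        unfolding orbit_sum_def by simp
      moreover have "0 \<le> ?f x \<and> ?f x \<le> 1" for x by (simp add: indicator_def)
      ultimately show ?thesis by (smt (verit))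
    qed
    have S: "\<bar>S n - R n\<bar> \<le> real m" for n
    proof -
      have "\<bar>S n - R n\<bar> \<le> (\<Sum>t<n. \<bar>of_bool (m \<le> t \<and> Q ((left_shift ^^ Suc t) \<omega>)) - ?f ((left_shift ^^ Suc t) \<omega>)\<bar>)"
        unfolding S_def R_def sum_subtractf[symmetric] by (rule sum_abs)
      also have "\<dots> \<le> (\<Sum>t<n. of_bool (t < m))"
        by (rule sum_mono) (auto simp: indicator_def simp del: funpow.simps)
      also have "\<dots> = real (card ({..<n} \<inter> {t. t < m}))" by simp
      also have "\<dots> \<le> real (card {..<m})" by (intro of_nat_mono card_mono) auto
      finally show ?thesis by simp
    qed
    have "\<bar>S n / real n - orbit_sum left_shift ?f n \<omega> / real n\<bar> \<le> (real m + 1) / real n" for n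
    proof -
      have "\<bar>S n - orbit_sum left_shift ?f n \<omega>\<bar> \<le> real m + 1" using S[of n] R[of n] by linarith
      then show ?thesis by (simp add: diff_divide_distrib[symmetric] abs_divide divide_right_mono)
    qed
    then have "(\<lambda>n. S n / real n - orbit_sum left_shift ?f n \<omega> / real n) \<longlonglongrightarrow> 0"
      by (intro Lim_null_comparison[OF _ lim_const_over_n[of "real m + 1"]]) auto
    from tendsto_add[OF this lim] have "(\<lambda>n. S n / real n) \<longlonglongrightarrow> (\<integral>\<omega>. ?f \<omega> \<partial>P)" by simp
    then show "(\<lambda>n. (\<Sum>t<n. of_bool (m \<le> t \<and> Q ((left_shift ^^ Suc t) \<omega>))) / real n)
           \<longlonglongrightarrow> prob {\<omega>. Q \<omega>}"
      using Q by (simp add: S_def)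
  qed
qed

lemma visits_frequency:
  "AE \<omega> in P. (\<lambda>n. visits w (map \<omega> [1..int n]) / real n) \<longlonglongrightarrow> string_prob P w"
  unfolding visits_sample string_prob_eq by (rule occurrence_frequency) simp

lemma visits_then_frequency:
  "AE \<omega> in P. (\<lambda>n. visits_then w a (map \<omega> [1..int n]) / real n) \<longlonglongrightarrow> string_prob P (w @ [a])"
  unfolding visits_then_sample string_prob_snoc
  by (rule occurrence_frequency[where Q = "\<lambda>\<omega>. past_is w \<omega> \<and> \<omega> 0 = a"]) (rule snoc_event)

lemma next_prob_bounds: "0 \<le> next_prob P a s" "next_prob P a s \<le> 1"
proof -
  have "string_prob P (s @ [a]) \<le> string_prob P s"
    unfolding sum_string_prob_snoc[of s, symmetric] by (rule member_le_sum) auto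
  then show "0 \<le> next_prob P a s" "next_prob P a s \<le> 1"
    by (auto simp: next_prob_eq divide_le_eq_1 intro: order.not_eq_order_implies_strict)
qed

lemma sum_string_prob_length: "(\<Sum>x | length x = n. string_prob P x) = 1"
  using prob_sample[of "\<lambda>_. True" n] prob_space by simp

text \<open>
  If \<open>u\<close> determines the next symbol, the next symbol has the same conditional law after every past
  that ends with \<open>w\<close>. So \<open>D\<close> is a martingale: in the step from \<open>n\<close> to \<open>n + 1\<close> the cross terms cancel, and
  the new increment adds at most 1 to the second moment.
\<close>

lemma visits_second_moment:
  fixes a :: 'a
  assumes det: "determines_next P u" and uw: "suffix u w"
  defines "D \<equiv> \<lambda>x. visits_then w a x - next_prob P a u * visits w x"
  shows "(\<Sum>x | length x = n. string_prob P x * (D x)\<^sup>2) \<le> real n"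
proof (induction n)
  case 0
  then show ?case by (simp add: D_def visits_def visits_then_def)
next
  case (Suc n)
  define p where "p = next_prob P a u"
  have p: "0 \<le> p" "p \<le> 1" using next_prob_bounds by (auto simp: p_def)
  have "(\<Sum>b\<in>UNIV. string_prob P (y @ [b]) * (D (y @ [b]))\<^sup>2) \<le> string_prob P y * (D y)\<^sup>2 + string_prob P y" for y
  proof (cases "suffix w y")
    case False
    then have "D (y @ [b]) = D y" for b by (simp add: D_def visits_snoc visits_then_snoc)
    then show ?thesis by (simp add: sum_distrib_right[symmetric] sum_string_prob_snoc)
  next
    case True
    have next_a: "string_prob P (y @ [a]) = p * string_prob P y"
    proof (cases "string_prob P y = 0")
      case False
      then have "string_prob P y > 0" using string_prob_nonneg[of y] by linarith
      moreover have "suffix u y" using uw True by (rule suffix_order.trans)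
      ultimately have "next_prob P a y = p" using det by (auto simp: determines_next_def p_def)
      then show ?thesis by (simp add: string_prob_snoc_next)
    qed (simp add: string_prob_prefix_0)
    have "D (y @ [b]) = D y - p + of_bool (b = a)" for b
      using True by (simp add: D_def visits_snoc visits_then_snoc p_def algebra_simps)
    then have "string_prob P (y @ [b]) * (D (y @ [b]))\<^sup>2 = string_prob P (y @ [b]) * (D y - p)\<^sup>2
            + (if b = a then string_prob P (y @ [b]) * (2 * (D y - p) + 1) else 0)" for b
      by (cases "b = a") (simp_all only: power2_eq_square of_bool_eq simp_thms if_True if_False, simp_all add: algebra_simps)
    then have "(\<Sum>b\<in>UNIV. string_prob P (y @ [b]) * (D (y @ [b]))\<^sup>2) =
       (\<Sum>b\<in>UNIV. string_prob P (y @ [b]) * (D y - p)\<^sup>2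
            + (if b = a then string_prob P (y @ [b]) * (2 * (D y - p) + 1) else 0))"
      by (intro sum.cong) simp_all
    also have "\<dots> = string_prob P y * (D y - p)\<^sup>2 + string_prob P (y @ [a]) * (2 * (D y - p) + 1)"
      by (simp add: sum.distrib sum_distrib_right[symmetric] sum_string_prob_snoc)
    also have "\<dots> = string_prob P y * (D y)\<^sup>2 + string_prob P y * (p * (1 - p))"
      unfolding next_a by (simp add: power2_eq_square algebra_simps)
    also have "\<dots> \<le> string_prob P y * (D y)\<^sup>2 + string_prob P y * 1"
      using p by (intro add_left_mono mult_left_mono mult_le_one) auto
    finally show ?thesis by simp
  qed
  then have "(\<Sum>x | length x = Suc n. string_prob P x * (D x)\<^sup>2)
      \<le> (\<Sum>y | length y = n. string_prob P y * (D y)\<^sup>2 + string_prob P y)"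
    unfolding sum_lists_Suc by (rule sum_mono)
  also have "\<dots> \<le> real n + 1"
    using Suc by (simp add: sum.distrib sum_string_prob_length)
  finally show ?case by simp
qed

text \<open>
  Chebyshev's inequality.
\<close>

lemma visits_deviation:
  assumes det: "determines_next P u" and uw: "suffix u w" and c: "c > 0"
  shows "prob {\<omega>. \<bar>visits_then w a (map \<omega> [1..int n]) - next_prob P a u * visits w (map \<omega> [1..int n])\<bar> > c}
           \<le> real n / c\<^sup>2"
proof -
  define D where "D x = visits_then w a x - next_prob P a u * visits w x" for x
  have fin: "finite {x :: 'a list. length x = n}"
    using finite_lists_length_eq[of "UNIV :: 'a set" n] by simp
  have "prob {\<omega>. \<bar>D (map \<omega> [1..int n])\<bar> > c} = (\<Sum>x | length x = n \<and> \<bar>D x\<bar> > c. string_prob P x)"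
    by (rule prob_sample)
  also have "\<dots> \<le> (\<Sum>x | length x = n \<and> \<bar>D x\<bar> > c. string_prob P x * (D x)\<^sup>2 / c\<^sup>2)"
  proof (rule sum_mono)
    fix x assume "x \<in> {x. length x = n \<and> \<bar>D x\<bar> > c}"
    then have "c\<^sup>2 \<le> (D x)\<^sup>2" using c by (auto simp: abs_le_square_iff[symmetric])
    then have "string_prob P x * c\<^sup>2 \<le> string_prob P x * (D x)\<^sup>2" by (rule mult_left_mono) simp
    then show "string_prob P x \<le> string_prob P x * (D x)\<^sup>2 / c\<^sup>2"
      using c by (simp add: le_divide_eq)
  qed
  also have "\<dots> \<le> (\<Sum>x | length x = n. string_prob P x * (D x)\<^sup>2 / c\<^sup>2)"
    by (rule sum_mono2[OF fin]) auto
  also have "\<dots> = (\<Sum>x | length x = n. string_prob P x * (D x)\<^sup>2) / c\<^sup>2"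
    by (simp add: sum_divide_distrib)
  also have "\<dots> \<le> real n / c\<^sup>2"
    using visits_second_moment[OF det uw, of a n] by (intro divide_right_mono) (auto simp: D_def)
  finally show ?thesis by (simp add: D_def)
qed

text \<open>
  A refutation requires that one of the two visit counts compared deviates from its conditional mean by
  more than \<open>n\<^sup>3\<^sup>/\<^sup>4\<close>; there are at most order \<open>n\<^sup>1\<^sup>/\<^sup>4\<close> such counts, each deviating with
  probability at most \<open>n\<^sup>-\<^sup>1\<^sup>/\<^sup>2\<close>.
\<close>

lemma refutes_determining_rarely:
  assumes det: "determines_next P u"
  shows "(\<lambda>n. prob {\<omega>. refutes_determining (map \<omega> [1..int n]) u}) \<longlonglongrightarrow> 0"
proof (rule tendsto_sandwich[OF _ _ tendsto_const])
  define B where "B n w a = {\<omega>. \<bar>visits_then w a (map \<omega> [1..int n])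
      - next_prob P a u * visits w (map \<omega> [1..int n])\<bar> > real n powr (3/4)}" for n w a
  have B_event: "B n w a \<in> events" for n w a unfolding B_def by (rule window_event)
  have bound: "prob {\<omega>. refutes_determining (map \<omega> [1..int n]) u}
      \<le> (real n powr (1/4) + 1) * real CARD('a) * (real n / (real n powr (3/4))\<^sup>2)" if n: "n > 0" for n
  proof -
    define I where "I = {w \<in> test_strings n. suffix u w} \<times> (UNIV :: 'a set)"
    have finI: "finite I" unfolding I_def
      by (intro finite_cartesian_product finite_subset[OF _ finite_card_test_strings(1)[of n]]) auto
    have "{\<omega>. refutes_determining (map \<omega> [1..int n]) u} \<subseteq> (\<Union>(w, a)\<in>I. B n w a)"
    proof
      fix \<omega> assume "\<omega> \<in> {\<omega>. refutes_determining (map \<omega> [1..int n]) u}"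
      then obtain w w' a where w: "w \<in> test_strings n" "w' \<in> test_strings n" "suffix u w" "suffix u w'"
        and big: "\<bar>visits_then w a (map \<omega> [1..int n]) * visits w' (map \<omega> [1..int n])
            - visits_then w' a (map \<omega> [1..int n]) * visits w (map \<omega> [1..int n])\<bar> > 2 * real n powr (7/4)"
        unfolding refutes_determining_def length_sample mem_Collect_eq by blast
      define x where "x = map \<omega> [1..int n]"
      define p where "p = next_prob P a u"
      define c where "c = real n powr (3/4)"
      have c: "c * real n = real n powr (7/4)"
        using n powr_add[of "real n" "3/4" 1] by (simp add: c_def)
      have "\<not> (\<bar>visits_then w a x - p * visits w x\<bar> \<le> c \<and> \<bar>visits_then w' a x - p * visits w' x\<bar> \<le> c)"
      proof
        assume small: "\<bar>visits_then w a x - p * visits w x\<bar> \<le> c \<and> \<bar>visits_then w' a x - p * visits w' x\<bar> \<le> c"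
        have le: "\<bar>visits v x\<bar> \<le> real n" for v using visits_bounds[of v x] by (simp add: x_def)
        have "visits_then w a x * visits w' x - visits_then w' a x * visits w x
            = (visits_then w a x - p * visits w x) * visits w' x
              - (visits_then w' a x - p * visits w' x) * visits w x"
          by (simp add: algebra_simps)
        also have "\<bar>\<dots>\<bar> \<le> \<bar>visits_then w a x - p * visits w x\<bar> * \<bar>visits w' x\<bar>
              + \<bar>visits_then w' a x - p * visits w' x\<bar> * \<bar>visits w x\<bar>"
          unfolding abs_mult[symmetric] by (rule abs_triangle_ineq4)
        also have "\<dots> \<le> c * real n + c * real n"
          using small le by (intro add_mono mult_mono) (auto simp: c_def)
        finally show False using big unfolding c by (simp add: x_def)
      qed
      then have "\<omega> \<in> B n w a \<or> \<omega> \<in> B n w' a" by (auto simp: B_def x_def p_def c_def)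
      then show "\<omega> \<in> (\<Union>(w, a)\<in>I. B n w a)" using w by (auto simp: I_def)
    qed
    then have "prob {\<omega>. refutes_determining (map \<omega> [1..int n]) u} \<le> prob (\<Union>(w, a)\<in>I. B n w a)"
      using finI B_event by (intro finite_measure_mono) auto
    also have "\<dots> \<le> (\<Sum>i\<in>I. prob (case i of (w, a) \<Rightarrow> B n w a))"
      by (rule finite_measure_subadditive_finite[OF finI]) (use B_event in auto)
    also have "\<dots> \<le> (\<Sum>i\<in>I. real n / (real n powr (3/4))\<^sup>2)"
    proof (rule sum_mono)
      fix i assume "i \<in> I"
      then obtain w a where i: "i = (w, a)" "suffix u w" by (auto simp: I_def)
      show "prob (case i of (w, a) \<Rightarrow> B n w a) \<le> real n / (real n powr (3/4))\<^sup>2"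
        unfolding i B_def prod.case by (rule visits_deviation[OF det i(2)]) (use n in simp)
    qed
    also have "\<dots> = real (card I) * (real n / (real n powr (3/4))\<^sup>2)" by simp
    also have "\<dots> \<le> (real n powr (1/4) + 1) * real CARD('a) * (real n / (real n powr (3/4))\<^sup>2)"
    proof (rule mult_right_mono)
      have "card {w \<in> test_strings n. suffix u w} \<le> card (test_strings n :: 'a list set)"
        by (rule card_mono) (auto simp: finite_card_test_strings)
      then have "real (card {w \<in> test_strings n. suffix u w}) \<le> real n powr (1/4) + 1"
        using finite_card_test_strings(2)[of n, where 'a = 'a] by linarith
      then show "real (card I) \<le> (real n powr (1/4) + 1) * real CARD('a)"
        unfolding I_def card_cartesian_product of_nat_mult by (rule mult_right_mono) simp
    qed simp
    finally show ?thesis .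
  qed
  show "eventually (\<lambda>n. prob {\<omega>. refutes_determining (map \<omega> [1..int n]) u}
      \<le> (real n powr (1/4) + 1) * real CARD('a) * (real n / (real n powr (3/4))\<^sup>2)) sequentially"
    using eventually_gt_at_top[of 0] by eventually_elim (rule bound)
  show "(\<lambda>n. (real n powr (1/4) + 1) * real CARD('a) * (real n / (real n powr (3/4))\<^sup>2)) \<longlonglongrightarrow> 0"
    by real_asymp
qed (simp add: measure_nonneg)

text \<open>
  Some extension \<open>w\<close> of \<open>u\<close> has a different conditional probability for some \<open>a\<close>. The comparison
  of \<open>w\<close> with \<open>u\<close> itself then has size about \<open>\<bar>\<delta>\<bar> n\<^sup>2\<close>, which beats the threshold.
\<close>

lemma refutes_determining_eventually:
  assumes "\<not> determines_next P u" and pos: "string_prob P u > 0"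
  shows "AE \<omega> in P. eventually (\<lambda>n. refutes_determining (map \<omega> [1..int n]) u) sequentially"
proof -
  obtain a w where w: "string_prob P w > 0" "suffix u w" "next_prob P a w \<noteq> next_prob P a u"
    using assms by (auto simp: determines_next_def)
  define \<delta> where "\<delta> = string_prob P (w @ [a]) * string_prob P u - string_prob P (u @ [a]) * string_prob P w"
  have \<delta>: "\<delta> \<noteq> 0"
  proof -
    have "\<delta> = (next_prob P a w - next_prob P a u) * (string_prob P w * string_prob P u)"
      by (simp add: \<delta>_def string_prob_snoc_next algebra_simps)
    then show ?thesis using w pos by simp
  qed
  show ?thesis
    using visits_frequency[of w] visits_frequency[of u] visits_then_frequency[of w a] visits_then_frequency[of u a]
  proof eventually_elim
    fix \<omega> :: "int \<Rightarrow> 'a"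
    define X where "X n = map \<omega> [1..int n]" for n
    assume "(\<lambda>n. visits w (map \<omega> [1..int n]) / real n) \<longlonglongrightarrow> string_prob P w"
      "(\<lambda>n. visits u (map \<omega> [1..int n]) / real n) \<longlonglongrightarrow> string_prob P u"
      "(\<lambda>n. visits_then w a (map \<omega> [1..int n]) / real n) \<longlonglongrightarrow> string_prob P (w @ [a])"
      "(\<lambda>n. visits_then u a (map \<omega> [1..int n]) / real n) \<longlonglongrightarrow> string_prob P (u @ [a])"
    then have "(\<lambda>n. \<bar>visits_then w a (X n) / real n * (visits u (X n) / real n)
        - visits_then u a (X n) / real n * (visits w (X n) / real n)\<bar>
        - 2 * real n powr (7/4) / (real n)\<^sup>2) \<longlonglongrightarrow> \<bar>\<delta>\<bar> - 0"
      unfolding \<delta>_def X_def by (intro tendsto_intros) (assumption | real_asymp)+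
    then have "eventually (\<lambda>n. \<bar>visits_then w a (X n) / real n * (visits u (X n) / real n)
        - visits_then u a (X n) / real n * (visits w (X n) / real n)\<bar>
        - 2 * real n powr (7/4) / (real n)\<^sup>2 > 0) sequentially"
      by (rule order_tendstoD) (use \<delta> in simp)
    then show "eventually (\<lambda>n. refutes_determining (map \<omega> [1..int n]) u) sequentially"
      using eventually_test_string[of w] eventually_test_string[of u] eventually_gt_at_top[of 0]
    proof eventually_elim
      fix n
      assume gt: "\<bar>visits_then w a (X n) / real n * (visits u (X n) / real n)
        - visits_then u a (X n) / real n * (visits w (X n) / real n)\<bar>
        - 2 * real n powr (7/4) / (real n)\<^sup>2 > 0"
        and W: "w \<in> test_strings n" "u \<in> test_strings n" and n: "0 < n"
      have "visits_then w a (X n) / real n * (visits u (X n) / real n)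
        - visits_then u a (X n) / real n * (visits w (X n) / real n) =
        (visits_then w a (X n) * visits u (X n) - visits_then u a (X n) * visits w (X n)) / (real n)\<^sup>2"
        by (simp add: power2_eq_square diff_divide_distrib)
      then have "2 * real n powr (7/4) / (real n)\<^sup>2
          < \<bar>visits_then w a (X n) * visits u (X n) - visits_then u a (X n) * visits w (X n)\<bar> / (real n)\<^sup>2"
        using gt by (simp add: abs_divide)
      then have "2 * real n powr (7/4) < \<bar>visits_then w a (X n) * visits u (X n) - visits_then u a (X n) * visits w (X n)\<bar>"
        using n by (simp add: divide_less_cancel)
      then show "refutes_determining (map \<omega> [1..int n]) u"
        unfolding refutes_determining_def length_sample using W w(2) unfolding X_def by blast
    qed
  qed
qed

lemma string_prob_append_le: "string_prob P (y @ z) \<le> string_prob P y"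
proof (induction z rule: rev_induct)
  case (snoc a z)
  have "string_prob P ((y @ z) @ [a]) \<le> string_prob P (y @ z)"
    unfolding sum_string_prob_snoc[of "y @ z", symmetric] by (rule member_le_sum) auto
  then show ?case using snoc by simp
qed simp

lemma visits_null_string:
  assumes "string_prob P v = 0" shows "prob {\<omega>. visits v (map \<omega> [1..int n]) > 0} = 0"
  unfolding prob_sample[where F = "\<lambda>x. visits v x > 0"]
proof (intro sum.neutral ballI)
  fix x assume "x \<in> {x. length x = n \<and> 0 < visits v x}"
  then have "visits v x \<noteq> 0" by simp
  then obtain t where "suffix v (take t x)"
    unfolding visits_def by (metis (mono_tags, lifting) of_bool_eq(1) sum.neutral)
  then have "string_prob P (take t x) = 0"
    using string_prob_suffix[of v "take t x"] assms string_prob_nonneg[of "take t x"] by linarith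
  then show "string_prob P x = 0"
    using string_prob_append_le[of "take t x" "drop t x"] string_prob_nonneg[of x] by simp
qed

text \<open>
  A node has only finitely many proper suffixes, and all of them are eventually refuted. A string
  that is not a node has probability zero and never occurs, or has a determining proper suffix,
  which is rarely refuted.
\<close>

theorem accepts_node_consistent:
  "(\<lambda>n. prob {\<omega>. accepts_node (map \<omega> [1..int n]) v \<noteq> node v}) \<longlonglongrightarrow> 0"
proof (cases "node v")
  case True
  have fin: "finite {u. strict_suffix u v}"
    by (rule finite_subset[of _ "set (suffixes v)"]) (auto simp: strict_suffix_def)
  have "AE \<omega> in P. \<forall>u\<in>{u. strict_suffix u v}.
      eventually (\<lambda>n. refutes_determining (map \<omega> [1..int n]) u) sequentially"
  proof (rule AE_finite_allI[OF fin])
    fix u assume "u \<in> {u. strict_suffix u v}"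
    then have "\<not> determines_next P u" "string_prob P u > 0"
      using True node_suffix[OF True, of u] by (auto simp: node_def strict_suffix_def)
    then show "AE \<omega> in P. eventually (\<lambda>n. refutes_determining (map \<omega> [1..int n]) u) sequentially"
      by (rule refutes_determining_eventually)
  qed
  with visits_frequency[of v] have "AE \<omega> in P. eventually (\<lambda>n.
      \<not> (accepts_node (map \<omega> [1..int n]) v \<noteq> node v)) sequentially"
  proof eventually_elim
    fix \<omega>
    assume lim: "(\<lambda>n. visits v (map \<omega> [1..int n]) / real n) \<longlonglongrightarrow> string_prob P v"
      and ref: "\<forall>u\<in>{u. strict_suffix u v}. eventually (\<lambda>n. refutes_determining (map \<omega> [1..int n]) u) sequentially"
    have "eventually (\<lambda>n. visits v (map \<omega> [1..int n]) / real n > 0) sequentially"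
      using lim by (rule order_tendstoD) (use True in \<open>simp add: node_def\<close>)
    moreover have "eventually (\<lambda>n. \<forall>u\<in>{u. strict_suffix u v}. refutes_determining (map \<omega> [1..int n]) u) sequentially"
      using eventually_ball_finite[OF fin ref] .
    ultimately show "eventually (\<lambda>n. \<not> (accepts_node (map \<omega> [1..int n]) v \<noteq> node v)) sequentially"
      by eventually_elim (use True in \<open>auto simp: accepts_node_def zero_less_divide_iff\<close>)
  qed
  then show ?thesis
    using AE_eventually_imp_prob_tendsto_0[of "\<lambda>n \<omega>. accepts_node (map \<omega> [1..int n]) v \<noteq> node v"]
      window_event[of "\<lambda>x. accepts_node x v \<noteq> node v"] by simp
next
  case False
  then consider "string_prob P v = 0" | u where "strict_suffix u v" "determines_next P u"
    unfolding node_def by (metis less_eq_real_def string_prob_nonneg)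
  then show ?thesis
  proof cases
    case 1
    have "prob {\<omega>. accepts_node (map \<omega> [1..int n]) v \<noteq> node v} = 0" for n
    proof -
      have "prob {\<omega>. accepts_node (map \<omega> [1..int n]) v \<noteq> node v} \<le> prob {\<omega>. visits v (map \<omega> [1..int n]) > 0}"
        by (rule finite_measure_mono) (use False in \<open>auto simp: accepts_node_def\<close>)
      then show ?thesis unfolding visits_null_string[OF 1, of n] measure_le_0_iff .
    qed
    then show ?thesis by simp
  next
    case 2
    have "prob {\<omega>. accepts_node (map \<omega> [1..int n]) v \<noteq> node v}
        \<le> prob {\<omega>. refutes_determining (map \<omega> [1..int n]) u}" for n
      by (rule finite_measure_mono) (use False 2(1) in \<open>auto simp: accepts_node_def\<close>)
    then show ?thesis
      by (intro tendsto_sandwich[OF _ _ tendsto_const refutes_determining_rarely[OF 2(2)]]) auto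
  qed
qed

end

section \<open>Summable weights: a consistent estimator\<close>

lemma Fin_Nil_irreducible: "{Fin []} \<in> irreducible_trees"
  by (auto simp: irreducible_trees_def is_tree_def)

definition agrees_upto :: "nat \<Rightarrow> 'a::countable list \<Rightarrow> 'a sequence set \<Rightarrow> bool" where
  "agrees_upto k x \<tau> \<longleftrightarrow> (\<forall>v. length v \<le> k \<longrightarrow> (v \<in> nodes \<tau> \<longleftrightarrow> accepts_node x v))"

text \<open>
  The levels up to which some irreducible tree matches the tests. The bound by the sample size only
  serves to make the set finite.
\<close>

definition resolved_levels :: "'a::countable list \<Rightarrow> nat set" where
  "resolved_levels x = {k. k \<le> length x \<and> (\<exists>\<tau>\<in>irreducible_trees. agrees_upto k x \<tau>)}"

definition tree_estimate :: "'a::countable list \<Rightarrow> 'a sequence set" where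
  "tree_estimate x = (if resolved_levels x = {} then {Fin []}
     else SOME \<tau>. \<tau> \<in> irreducible_trees \<and> agrees_upto (Max (resolved_levels x)) x \<tau>)"

text \<open>
  Whenever the tests up to level \<open>k\<close> are matched by an irreducible tree, in particular when they
  are all correct, the estimate matches them as well.
\<close>

lemma tree_estimate:
  shows "tree_estimate x \<in> irreducible_trees"
    and "k \<le> length x \<Longrightarrow> \<tau> \<in> irreducible_trees \<Longrightarrow> agrees_upto k x \<tau> \<Longrightarrow> agrees_upto k x (tree_estimate x)"
proof -
  let ?m = "Max (resolved_levels x)"
  have fin: "finite (resolved_levels x)"
    by (rule finite_subset[of _ "{..length x}"]) (auto simp: resolved_levels_def)
  have est: "tree_estimate x \<in> irreducible_trees \<and> agrees_upto ?m x (tree_estimate x)"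
    if "resolved_levels x \<noteq> {}"
  proof -
    have "?m \<in> resolved_levels x" using fin that by (rule Max_in)
    then have "\<exists>\<tau>. \<tau> \<in> irreducible_trees \<and> agrees_upto ?m x \<tau>" by (auto simp: resolved_levels_def)
    from someI_ex[OF this] show ?thesis using that by (simp add: tree_estimate_def)
  qed
  then show "tree_estimate x \<in> irreducible_trees"
    using Fin_Nil_irreducible by (cases "resolved_levels x = {}") (auto simp: tree_estimate_def)
  assume "k \<le> length x" "\<tau> \<in> irreducible_trees" "agrees_upto k x \<tau>"
  then have k: "k \<in> resolved_levels x" by (auto simp: resolved_levels_def)
  then have "k \<le> ?m" using fin by simp
  moreover have "agrees_upto ?m x (tree_estimate x)" using est k by blast
  ultimately show "agrees_upto k x (tree_estimate x)" by (auto simp: agrees_upto_def)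
qed

lemma ennreal_infsum_tail:
  fixes f :: "'b \<Rightarrow> ennreal"
  assumes "(\<Sum>\<^sub>\<infinity>v\<in>UNIV. f v) < \<infinity>" "(\<epsilon>::real) > 0"
  shows "\<exists>F. finite F \<and> (\<Sum>\<^sub>\<infinity>v\<in>-F. f v) < \<epsilon>"
proof -
  have summ: "f summable_on A" for A by (rule nonneg_summable_on_complete) simp
  let ?S = "\<Sum>\<^sub>\<infinity>v\<in>UNIV. f v"
  have split: "?S = sum f F + (\<Sum>\<^sub>\<infinity>v\<in>-F. f v)" if "finite F" for F
    using infsum_Un_disjoint[OF summ summ, of F "-F"] that by simp
  have S: "?S = (SUP F\<in>{F. finite F \<and> F \<subseteq> UNIV}. sum f F)"
    by (rule nonneg_infsum_complete) simp
  have "\<exists>F\<in>{F. finite F \<and> F \<subseteq> UNIV}. ?S < sum f F + \<epsilon>"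
    by (rule SUP_approx_ennreal[OF assms(2) _ S]) (use assms(1) in auto)
  then obtain F where F: "finite F" "?S < sum f F + \<epsilon>" by auto
  then have "(\<Sum>\<^sub>\<infinity>v\<in>-F. f v) < \<epsilon>"
    unfolding split[OF F(1)] by (simp add: ennreal_add_left_cancel_less)
  then show ?thesis using F(1) by blast
qed

lemma hamming_dist_le_tail:
  assumes "\<And>v. \<phi> v \<ge> 0" and "\<And>v. v \<in> F \<Longrightarrow> v \<in> nodes \<tau> \<longleftrightarrow> v \<in> nodes \<tau>'"
  shows "hamming_dist \<phi> \<tau> \<tau>' \<le> (\<Sum>\<^sub>\<infinity>v\<in>-F. ennreal (\<phi> v))"
  unfolding hamming_dist_def
proof (rule infsum_mono_neutral)
  fix v :: "'a list"
  assume "v \<in> UNIV \<inter> - F"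
  have "\<phi> v * \<bar>indicator (nodes \<tau>) v - indicator (nodes \<tau>') v\<bar> \<le> \<phi> v * 1"
    using assms(1) by (intro mult_left_mono) (auto simp: indicator_def)
  then show "ennreal (\<phi> v * \<bar>indicator (nodes \<tau>) v - indicator (nodes \<tau>') v\<bar>) \<le> ennreal (\<phi> v)"
    by (simp add: ennreal_leI)
qed (use assms in \<open>auto simp: indicator_def intro!: nonneg_summable_on_complete\<close>)

lemma (in ergodic_process) tree_estimate_agrees:
  "(\<lambda>n. prob {\<omega>. \<exists>v. length v \<le> k \<and> (v \<in> nodes (tree_estimate (map \<omega> [1..int n])) \<longleftrightarrow>
          v \<notin> nodes (context_tree P))}) \<longlonglongrightarrow> 0"
proof (rule tendsto_sandwich[OF _ _ tendsto_const])
  have fin: "finite {v :: 'a list. length v \<le> k}"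
    using finite_lists_length_le[of "UNIV :: 'a set" k] by simp
  show "eventually (\<lambda>n. prob {\<omega>. \<exists>v. length v \<le> k \<and> (v \<in> nodes (tree_estimate (map \<omega> [1..int n])) \<longleftrightarrow>
          v \<notin> nodes (context_tree P))}
     \<le> (\<Sum>v | length v \<le> k. prob {\<omega>. accepts_node (map \<omega> [1..int n]) v \<noteq> node v})) sequentially"
    using eventually_ge_at_top[of k]
  proof eventually_elim
    fix n assume n: "k \<le> n"
    have ev: "{\<omega>. accepts_node (map \<omega> [1..int n]) v \<noteq> node v} \<in> events" for v
      by (rule window_event)
    have "{\<omega>. \<exists>v. length v \<le> k \<and> (v \<in> nodes (tree_estimate (map \<omega> [1..int n])) \<longleftrightarrow> v \<notin> nodes (context_tree P))}
      \<subseteq> (\<Union>v\<in>{v. length v \<le> k}. {\<omega>. accepts_node (map \<omega> [1..int n]) v \<noteq> node v})"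
    proof (rule ccontr)
      assume "\<not> ?thesis"
      then obtain \<omega> v where v: "length v \<le> k"
          "v \<in> nodes (tree_estimate (map \<omega> [1..int n])) \<longleftrightarrow> v \<notin> nodes (context_tree P)"
        and acc: "\<And>v. length v \<le> k \<Longrightarrow> accepts_node (map \<omega> [1..int n]) v = node v"
        by blast
      have true: "agrees_upto k (map \<omega> [1..int n]) (context_tree P)"
        using acc by (auto simp: agrees_upto_def nodes_context_tree)
      have "agrees_upto k (map \<omega> [1..int n]) (tree_estimate (map \<omega> [1..int n]))"
        by (rule tree_estimate(2)[OF _ context_tree_irreducible true]) (use n in simp)
      then show False using true v by (auto simp: agrees_upto_def)
    qed
    then have "prob {\<omega>. \<exists>v. length v \<le> k \<and> (v \<in> nodes (tree_estimate (map \<omega> [1..int n])) \<longleftrightarrow> v \<notin> nodes (context_tree P))}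
      \<le> prob (\<Union>v\<in>{v. length v \<le> k}. {\<omega>. accepts_node (map \<omega> [1..int n]) v \<noteq> node v})"
      using fin ev by (intro finite_measure_mono) auto
    also have "\<dots> \<le> (\<Sum>v | length v \<le> k. prob {\<omega>. accepts_node (map \<omega> [1..int n]) v \<noteq> node v})"
      by (rule finite_measure_subadditive_finite[OF fin]) (use ev in auto)
    finally show "prob {\<omega>. \<exists>v. length v \<le> k \<and> (v \<in> nodes (tree_estimate (map \<omega> [1..int n])) \<longleftrightarrow>
          v \<notin> nodes (context_tree P))}
     \<le> (\<Sum>v | length v \<le> k. prob {\<omega>. accepts_node (map \<omega> [1..int n]) v \<noteq> node v})" .
  qed
  show "(\<lambda>n. \<Sum>v | length v \<le> k. prob {\<omega>. accepts_node (map \<omega> [1..int n]) v \<noteq> node v}) \<longlonglongrightarrow> 0"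
    by (rule tendsto_null_sum) (rule accepts_node_consistent)
qed simp

text \<open>
  Strings longer than a suitable \<open>k\<close> have total weight below \<open>\<epsilon>\<close>, so a larger error means
  that the estimate errs on one of the finitely many strings up to length \<open>k\<close>.
\<close>

theorem summable_imp_estimable:
  fixes \<phi> :: "'a::finite list \<Rightarrow> real"
  assumes nn: "\<And>v. \<phi> v \<ge> 0" and sum: "(\<Sum>\<^sub>\<infinity>v\<in>UNIV. ennreal (\<phi> v)) < \<infinity>"
  shows "consistently_estimable \<phi> stationary_ergodic context_tree"
  unfolding consistently_estimable_def
proof (intro exI[of _ "\<lambda>n. tree_estimate"] conjI allI impI ballI)
  show "tree_estimate x \<in> irreducible_trees" for x :: "'a list" by (rule tree_estimate(1))
  fix P :: "(int \<Rightarrow> 'a) measure" and \<epsilon> :: real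
  assume "P \<in> stationary_ergodic" and \<epsilon>: "0 < \<epsilon>"
  then interpret ergodic_process P by unfold_locales
  obtain F where F: "finite F" "(\<Sum>\<^sub>\<infinity>v\<in>-F. ennreal (\<phi> v)) < ennreal \<epsilon>"
    using ennreal_infsum_tail[OF sum \<epsilon>] by auto
  \<comment> \<open>The \<open>0\<close> covers the case of an empty \<open>F\<close>.\<close>
  define k where "k = Max (insert 0 (length ` F))"
  have k: "length v \<le> k" if "v \<in> F" for v
    unfolding k_def using F(1) that by (intro Max_ge) auto
  let ?bad = "\<lambda>n. {\<omega>. \<exists>v. length v \<le> k \<and> (v \<in> nodes (tree_estimate (map \<omega> [1..int n])) \<longleftrightarrow>
          v \<notin> nodes (context_tree P))}"
  show "(\<lambda>n. \<P>(\<omega> in P. hamming_dist \<phi> (tree_estimate (map \<omega> [1..int n])) (context_tree P) > ennreal \<epsilon>)) \<longlonglongrightarrow> 0"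
  proof (rule tendsto_sandwich[OF _ _ tendsto_const tree_estimate_agrees[of k]])
    have "{\<omega>. hamming_dist \<phi> (tree_estimate (map \<omega> [1..int n])) (context_tree P) > ennreal \<epsilon>} \<subseteq> ?bad n" for n
    proof (rule ccontr)
      assume "\<not> ?thesis"
      then obtain \<omega> where \<omega>: "hamming_dist \<phi> (tree_estimate (map \<omega> [1..int n])) (context_tree P) > ennreal \<epsilon>"
        "\<omega> \<notin> ?bad n" by blast
      have "hamming_dist \<phi> (tree_estimate (map \<omega> [1..int n])) (context_tree P) \<le> (\<Sum>\<^sub>\<infinity>v\<in>-F. ennreal (\<phi> v))"
        by (rule hamming_dist_le_tail) (use nn \<omega>(2) k in auto)
      then show False using \<omega>(1) F(2) by simp
    qed
    then show "eventually (\<lambda>n. \<P>(\<omega> in P. hamming_dist \<phi> (tree_estimate (map \<omega> [1..int n])) (context_tree P) > ennreal \<epsilon>)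
        \<le> prob (?bad n)) sequentially"
      using window_event[of "\<lambda>x. \<exists>v. length v \<le> k \<and> (v \<in> nodes (tree_estimate x) \<longleftrightarrow> v \<notin> nodes (context_tree P))"]
      by (intro always_eventually allI finite_measure_mono) auto
  qed simp
qed

section \<open>Ergodicity and resampling of i.i.d. sequences\<close>

text \<open>
  The events \<open>A\<close> for which the convergence holds form a Dynkin system. For countable disjoint unions,
  the limit and the sum may be exchanged because \<open>prob (A \<inter> C n) \<le> prob A\<close> uniformly in \<open>n\<close>.
\<close>

lemma (in prob_space) Dynkin_tendsto:
  assumes G: "Int_stable G" "G \<subseteq> Pow (space M)" "sets M = sigma_sets (space M) G"
    and C: "\<And>n. C n \<in> events" "(\<lambda>n. prob (C n)) \<longlonglongrightarrow> c"
    and gen: "\<And>A. A \<in> G \<Longrightarrow> (\<lambda>n. prob (A \<inter> C n)) \<longlonglongrightarrow> prob A * c"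
    and A: "A \<in> events"
  shows "(\<lambda>n. prob (A \<inter> C n)) \<longlonglongrightarrow> prob A * c"
proof -
  have "A \<in> sigma_sets (space M) G" using A G(3) by simp
  with G(1,2) show ?thesis
  proof (induction rule: sigma_sets_induct_disjoint)
    case (basic A)
    then show ?case by (rule gen)
  next
    case empty
    then show ?case by simp
  next
    case (compl A)
    then have A: "A \<in> events" using G(3) by simp
    have eq: "prob ((space M - A) \<inter> C n) = prob (C n) - prob (A \<inter> C n)" for n
    proof -
      have "(space M - A) \<inter> C n = C n - A \<inter> C n" using sets.sets_into_space[OF C(1)] by auto
      then show ?thesis using A C(1) by (simp add: finite_measure_Diff)
    qed
    then show ?case
      unfolding eq using tendsto_diff[OF C(2) compl(2)] A by (simp add: prob_compl algebra_simps)
  next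
    case (union A)
    then have A: "\<And>i. A i \<in> events" using G(3) by auto
    have disj: "disjoint_family (\<lambda>i. A i \<inter> C n)" for n
      using union(1) by (auto simp: disjoint_family_on_def)
    have sum1: "(\<lambda>i. prob (A i)) sums prob (\<Union>i. A i)"
      by (rule finite_measure_UNION) (use A union(1) in auto)
    have eq: "(\<Union>i. A i) \<inter> C n = (\<Union>i. A i \<inter> C n)" for n by auto
    have sum2: "(\<lambda>i. prob (A i \<inter> C n)) sums prob ((\<Union>i. A i) \<inter> C n)" for n
      unfolding eq by (rule finite_measure_UNION) (use A C(1) disj in auto)
    have "(\<lambda>n. \<Sum>i. prob (A i \<inter> C n)) \<longlonglongrightarrow> (\<Sum>i. prob (A i) * c)"
    proof (rule tannerys_theorem[where M = "\<lambda>i. prob (A i)", THEN conjunct2, THEN conjunct2])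
      show "summable (\<lambda>i. prob (A i))" using sum1 by (rule sums_summable)
      show "eventually (\<lambda>(k, n). norm (prob (A k \<inter> C n)) \<le> prob (A k)) (at_top \<times>\<^sub>F sequentially)"
        by (intro always_eventually) (use A C(1) in \<open>auto intro!: finite_measure_mono\<close>)
    qed (use union(3) in auto)
    moreover have "(\<Sum>i. prob (A i) * c) = prob (\<Union>i. A i) * c"
      using sums_mult2[OF sum1, of c] by (simp add: sums_iff)
    ultimately show ?case using sum2 by (simp add: sums_iff)
  qed
qed

locale iid_process =
  fixes q :: "'b::countable pmf"
begin

definition \<Omega> :: "(int \<Rightarrow> 'b) measure" where
  "\<Omega> = PiM UNIV (\<lambda>_. measure_pmf q)"

sublocale coordinates: product_prob_space "\<lambda>_. measure_pmf q" "UNIV :: int set"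
  by unfold_locales

sublocale prob_space \<Omega>
  unfolding \<Omega>_def by (rule coordinates.P.prob_space_axioms)

lemma space_\<Omega> [simp]: "space \<Omega> = UNIV"
  by (simp add: \<Omega>_def space_PiM)

lemma coordinate_measurable_\<Omega> [measurable]: "(\<lambda>z. z i) \<in> \<Omega> \<rightarrow>\<^sub>M count_space UNIV"
proof -
  have "(\<lambda>z. z i) \<in> \<Omega> \<rightarrow>\<^sub>M measure_pmf q"
    unfolding \<Omega>_def by (rule measurable_component_singleton) simp
  then show ?thesis by (simp add: measurable_pmf_measure2)
qed

definition box :: "int set \<Rightarrow> (int \<Rightarrow> 'b set) \<Rightarrow> (int \<Rightarrow> 'b) set" where
  "box J E = {z. \<forall>i\<in>J. z i \<in> E i}"

lemma prod_emb_box: "prod_emb UNIV (\<lambda>_. measure_pmf q) J (Pi\<^sub>E J E) = box J E"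
  by (auto simp: prod_emb_def box_def space_PiM PiE_iff)

lemma emeasure_box:
  assumes "finite J" shows "emeasure \<Omega> (box J E) = (\<Prod>i\<in>J. emeasure (measure_pmf q) (E i))"
  unfolding \<Omega>_def prod_emb_box[symmetric] by (rule coordinates.emeasure_PiM_emb) (use assms in auto)

lemma prob_box:
  assumes "finite J" shows "prob (box J E) = (\<Prod>i\<in>J. measure (measure_pmf q) (E i))"
  unfolding \<Omega>_def prod_emb_box[symmetric] by (rule coordinates.measure_PiM_emb) (use assms in auto)

lemma box_event: "finite J \<Longrightarrow> box J E \<in> events"
  unfolding \<Omega>_def prod_emb_box[symmetric] by (rule sets_PiM_I) auto

definition boxes :: "(int \<Rightarrow> 'b) set set" where
  "boxes = {box J E | J E. finite J}"

lemma boxes_generate: "Int_stable boxes" "boxes \<subseteq> Pow (space \<Omega>)" "events = sigma_sets (space \<Omega>) boxes"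
proof -
  have "boxes = prod_algebra UNIV (\<lambda>_. measure_pmf q)"
  proof (intro set_eqI iffI)
    fix A :: "(int \<Rightarrow> 'b) set" assume "A \<in> boxes"
    then obtain J E where A: "A = box J E" "finite J" by (auto simp: boxes_def)
    show "A \<in> prod_algebra UNIV (\<lambda>_. measure_pmf q)"
    proof (cases "J = {}")
      case True
      then have "A = box {0} (\<lambda>_. UNIV)" using A by (auto simp: box_def)
      then show ?thesis unfolding prod_emb_box[symmetric] by (auto intro!: prod_algebraI)
    next
      case False
      then show ?thesis using A unfolding prod_emb_box[symmetric] by (auto intro!: prod_algebraI)
    qed
  next
    fix A :: "(int \<Rightarrow> 'b) set" assume "A \<in> prod_algebra UNIV (\<lambda>_. measure_pmf q)"
    then show "A \<in> boxes" by (elim prod_algebraE) (auto simp: boxes_def prod_emb_box)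
  qed
  note eq = this
  show "Int_stable boxes" unfolding eq by (rule Int_stable_prod_algebra)
  show "boxes \<subseteq> Pow (space \<Omega>)" by simp
  show "events = sigma_sets (space \<Omega>) boxes"
    unfolding eq space_\<Omega> unfolding \<Omega>_def sets_PiM by simp
qed

lemma left_shift_measurable [measurable]: "left_shift \<in> \<Omega> \<rightarrow>\<^sub>M \<Omega>"
proof -
  have "(\<lambda>z i. z (i + 1)) \<in> \<Omega> \<rightarrow>\<^sub>M PiM UNIV (\<lambda>_. measure_pmf q)"
    by (rule measurable_PiM_single') (auto simp: measurable_pmf_measure2)
  then show ?thesis by (simp add: \<Omega>_def left_shift_def[abs_def])
qed

lemma left_shift_invariant: "distr \<Omega> \<Omega> left_shift = \<Omega>"
  using distr_PiM_reindex[of UNIV "\<lambda>_. measure_pmf q" "\<lambda>i :: int. i + 1" UNIV]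
  by (simp add: \<Omega>_def left_shift_def[abs_def] inj_on_def restrict_def measure_pmf.prob_space_axioms)

lemma vimage_shift_box: "(left_shift ^^ n) -` box K F = box ((\<lambda>i. i + int n) ` K) (\<lambda>i. F (i - int n))"
  by (auto simp: box_def funpow_left_shift)

text \<open>
  Once the shift has moved the coordinates of one box away from those of the other, the two are
  independent.
\<close>

lemma boxes_mixing:
  assumes J: "finite J" and K: "finite K"
  shows "(\<lambda>n. prob (box J E \<inter> (left_shift ^^ n) -` box K F)) \<longlonglongrightarrow> prob (box J E) * prob (box K F)"
proof (rule tendsto_eventually)
  \<comment> \<open>For shifts by at least \<open>N\<close>, every shifted coordinate of \<open>K\<close> exceeds all of \<open>J\<close>.\<close>
  define N where "N = nat (Max (insert 0 J) - Min (insert 0 K)) + 1"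
  have "prob (box J E \<inter> (left_shift ^^ n) -` box K F) = prob (box J E) * prob (box K F)" if n: "n \<ge> N" for n
  proof -
    let ?K = "(\<lambda>i. i + int n) ` K"
    have disj: "J \<inter> ?K = {}"
    proof (rule ccontr)
      assume "J \<inter> ?K \<noteq> {}"
      then obtain i where i: "i \<in> K" "i + int n \<in> J" by auto
      have "i + int n \<le> Max (insert 0 J)" using i J by (intro Max_ge) auto
      moreover have "Min (insert 0 K) \<le> i" using i K by (intro Min_le) auto
      ultimately show False using n by (simp add: N_def)
    qed
    define E' where "E' i = (if i \<in> J then E i else F (i - int n))" for i
    have "box J E \<inter> (left_shift ^^ n) -` box K F = box (J \<union> ?K) E'"
    proof -
      have K': "(\<forall>i\<in>?K. z i \<in> F (i - int n)) \<longleftrightarrow> (\<forall>i\<in>?K. z i \<in> E' i)" for z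
        by (rule ball_cong) (use disj in \<open>auto simp: E'_def\<close>)
      have J': "(\<forall>i\<in>J. z i \<in> E i) \<longleftrightarrow> (\<forall>i\<in>J. z i \<in> E' i)" for z
        by (rule ball_cong) (auto simp: E'_def)
      show ?thesis
        unfolding vimage_shift_box
        by (rule set_eqI) (simp only: box_def mem_Collect_eq Int_iff ball_Un K' J')
    qed
    also have "prob \<dots> = (\<Prod>i\<in>J \<union> ?K. measure (measure_pmf q) (E' i))"
      using J K by (intro prob_box) simp
    also have "\<dots> = (\<Prod>i\<in>J. measure (measure_pmf q) (E' i)) * (\<Prod>i\<in>?K. measure (measure_pmf q) (E' i))"
      using J K disj by (intro prod.union_disjoint) auto
    also have "(\<Prod>i\<in>J. measure (measure_pmf q) (E' i)) = prob (box J E)"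
      unfolding prob_box[OF J] by (rule prod.cong) (auto simp: E'_def)
    also have "(\<Prod>i\<in>?K. measure (measure_pmf q) (E' i)) = (\<Prod>i\<in>K. measure (measure_pmf q) (E' (i + int n)))"
      by (subst prod.reindex) (auto simp: inj_on_def)
    also have "\<dots> = prob (box K F)"
      unfolding prob_box[OF K] by (rule prod.cong) (use disj in \<open>auto simp: E'_def\<close>)
    finally show ?thesis .
  qed
  then show "eventually (\<lambda>n. prob (box J E \<inter> (left_shift ^^ n) -` box K F) = prob (box J E) * prob (box K F)) sequentially"
    by (rule eventually_sequentiallyI)
qed

text \<open>
  Mixing against boxes shows that an invariant event \<open>E\<close> is independent of every box, since the
  sequence in question is then constant; a second Dynkin argument shows that \<open>E\<close> is independent of
  itself.
\<close>

sublocale ergodic_map \<Omega> left_shift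
proof
  show "left_shift \<in> \<Omega> \<rightarrow>\<^sub>M \<Omega>" "distr \<Omega> \<Omega> left_shift = \<Omega>"
    by (rule left_shift_measurable left_shift_invariant)+
  fix E assume E: "E \<in> events" "left_shift -` E \<inter> space \<Omega> = E"
  have invn: "(left_shift ^^ n) -` E = E" for n
  proof (induction n)
    case (Suc n)
    have "(left_shift ^^ Suc n) -` E = (left_shift ^^ n) -` (left_shift -` E)"
      by (auto simp: vimage_def)
    also have "left_shift -` E = E" using E(2) by simp
    also have "(left_shift ^^ n) -` E = E" by (rule Suc)
    finally show ?case .
  qed simp
  have shift_prob: "prob ((left_shift ^^ n) -` A) = prob A" if "A \<in> events" for n and A
  proof (induction n)
    case (Suc n)
    have [measurable]: "(left_shift ^^ n) \<in> \<Omega> \<rightarrow>\<^sub>M \<Omega>" by (rule measurable_compose_n) (rule left_shift_measurable)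
    have "(left_shift ^^ n) -` A \<inter> space \<Omega> \<in> events" using that by measurable
    then have "measure (distr \<Omega> \<Omega> left_shift) ((left_shift ^^ n) -` A)
        = prob (left_shift -` ((left_shift ^^ n) -` A))"
      by (subst measure_distr) auto
    also have "left_shift -` ((left_shift ^^ n) -` A) = (left_shift ^^ Suc n) -` A"
      by (simp only: funpow_Suc_right vimage_comp)
    finally show ?case using Suc by (simp only: left_shift_invariant)
  qed simp
  have indep: "prob (box K F \<inter> E) = prob (box K F) * prob E" if K: "finite K" for K F
  proof -
    have "(\<lambda>n. prob (E \<inter> (left_shift ^^ n) -` box K F)) \<longlonglongrightarrow> prob E * prob (box K F)"
    proof (rule Dynkin_tendsto[OF boxes_generate _ _ _ E(1)])
      show ev: "(left_shift ^^ n) -` box K F \<in> events" for n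
        unfolding vimage_shift_box using K by (intro box_event) simp
      show "(\<lambda>n. prob ((left_shift ^^ n) -` box K F)) \<longlonglongrightarrow> prob (box K F)"
        using shift_prob[OF box_event[OF K]] by simp
      show "(\<lambda>n. prob (A \<inter> (left_shift ^^ n) -` box K F)) \<longlonglongrightarrow> prob A * prob (box K F)" if "A \<in> boxes" for A
        using that boxes_mixing[OF _ K] by (auto simp: boxes_def)
    qed
    moreover have "prob (E \<inter> (left_shift ^^ n) -` box K F) = prob (box K F \<inter> E)" for n
    proof -
      have "E \<inter> (left_shift ^^ n) -` box K F = (left_shift ^^ n) -` (box K F \<inter> E)"
        using invn[of n] by auto
      then show ?thesis using shift_prob[of "box K F \<inter> E" n] box_event[OF K] E(1) by simp
    qed
    ultimately show ?thesis by (simp add: LIMSEQ_const_iff mult.commute)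
  qed
  have "(\<lambda>n :: nat. prob (E \<inter> E)) \<longlonglongrightarrow> prob E * prob E"
    by (rule Dynkin_tendsto[OF boxes_generate _ _ _ E(1)]) (use E(1) indep in \<open>auto simp: boxes_def\<close>)
  then have "prob E = prob E * prob E" by (simp add: LIMSEQ_const_iff)
  then show "prob E = 0 \<or> prob E = 1" by simp
qed

lemma resample_measurable: "(\<lambda>(y, z). z(t := y)) \<in> measure_pmf q \<Otimes>\<^sub>M \<Omega> \<rightarrow>\<^sub>M \<Omega>"
proof -
  have meas: "(\<lambda>(y, z). z(t := y)) \<in> measure_pmf q \<Otimes>\<^sub>M \<Omega> \<rightarrow>\<^sub>M PiM UNIV (\<lambda>_. measure_pmf q)"
  proof (rule measurable_PiM_single')
    fix i :: int
    show "(\<lambda>x. (case x of (y, z) \<Rightarrow> z(t := y)) i) \<in> measure_pmf q \<Otimes>\<^sub>M \<Omega> \<rightarrow>\<^sub>M measure_pmf q"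
    proof (cases "i = t")
      case True
      then have eq: "(\<lambda>x. (case x of (y, z) \<Rightarrow> z(t := y)) i) = fst" by (auto simp: fun_eq_iff)
      show ?thesis unfolding eq by (rule measurable_fst)
    next
      case False
      then have eq: "(\<lambda>x. (case x of (y, z) \<Rightarrow> z(t := y)) i) = (\<lambda>x. snd x i)" by (auto simp: fun_eq_iff)
      have "(\<lambda>x. snd x i) \<in> measure_pmf q \<Otimes>\<^sub>M \<Omega> \<rightarrow>\<^sub>M count_space UNIV"
        by (rule measurable_compose[OF measurable_snd coordinate_measurable_\<Omega>])
      then show ?thesis unfolding eq by (simp add: measurable_pmf_measure2)
    qed
  qed auto
  then show ?thesis by (simp add: \<Omega>_def)
qed

lemma distr_resample:
  "distr (measure_pmf q \<Otimes>\<^sub>M \<Omega>) \<Omega> (\<lambda>(y, z). z(t := y)) = \<Omega>"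
proof -
  interpret pair: pair_prob_space "measure_pmf q" \<Omega> by unfold_locales
  interpret D: prob_space "distr (measure_pmf q \<Otimes>\<^sub>M \<Omega>) \<Omega> (\<lambda>(y, z). z(t := y))"
    by (rule pair.prob_space_distr[OF resample_measurable])
  show ?thesis
    unfolding \<Omega>_def[symmetric]
  proof (rule measure_eqI_PiM_infinite[where I = UNIV and M = "\<lambda>_. measure_pmf q"])
    fix J :: "int set" and A :: "int \<Rightarrow> 'b set"
    assume J: "finite J"
    define A' where "A' = (if t \<in> J then A t else UNIV)"
    have "emeasure (distr (measure_pmf q \<Otimes>\<^sub>M \<Omega>) \<Omega> (\<lambda>(y, z). z(t := y))) (box J A)
        = emeasure (measure_pmf q \<Otimes>\<^sub>M \<Omega>) ((\<lambda>(y, z). z(t := y)) -` box J A \<inter> space (measure_pmf q \<Otimes>\<^sub>M \<Omega>))"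
      by (rule emeasure_distr[OF resample_measurable box_event[OF J]])
    also have "(\<lambda>(y, z). z(t := y)) -` box J A \<inter> space (measure_pmf q \<Otimes>\<^sub>M \<Omega>) = A' \<times> box (J - {t}) A"
      by (auto simp: space_pair_measure box_def A'_def split: if_splits)
    also have "emeasure (measure_pmf q \<Otimes>\<^sub>M \<Omega>) \<dots> = emeasure (measure_pmf q) A' * emeasure \<Omega> (box (J - {t}) A)"
      by (rule emeasure_pair_measure_Times) (use box_event J in auto)
    also have "\<dots> = emeasure \<Omega> (box J A)"
    proof (cases "t \<in> J")
      case True
      then show ?thesis using J by (simp add: emeasure_box A'_def prod.remove[of J t])
    next
      case False
      then show ?thesis by (simp add: A'_def measure_pmf.emeasure_space_1[simplified])
    qed
    finally show "emeasure (distr (measure_pmf q \<Otimes>\<^sub>M \<Omega>) \<Omega> (\<lambda>(y, z). z(t := y)))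
          (prod_emb UNIV (\<lambda>_. measure_pmf q) J (Pi\<^sub>E J A))
        = emeasure \<Omega> (prod_emb UNIV (\<lambda>_. measure_pmf q) J (Pi\<^sub>E J A))"
      unfolding prod_emb_box .
  qed (auto simp: \<Omega>_def D.finite_measure_axioms[unfolded \<Omega>_def])
qed

lemma coordinate_event:
  assumes "\<And>y. {z. G y z} \<in> events" shows "{z. G (z t) z} \<in> events"
proof -
  have "{z. G (z t) z} = (\<Union>y. ((\<lambda>z. z t) -` {y} \<inter> space \<Omega>) \<inter> {z. G y z})" by auto
  also have "\<dots> \<in> events"
  proof -
    have "(\<lambda>z. z t) -` {y} \<inter> space \<Omega> \<inter> {z. G y z} \<in> events" for y
      by (intro sets.Int measurable_sets[OF coordinate_measurable_\<Omega>] assms) simp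
    then show ?thesis by (intro sets.countable_UN') auto
  qed
  finally show ?thesis .
qed

text \<open>
  Conditioning on the coordinate \<open>z t\<close>, in the form of drawing it separately from the others, as
  the events for fixed values \<open>y\<close> do not involve it.
\<close>

lemma prob_resample:
  assumes G: "\<And>y. {z. G y z} \<in> events" and indep: "\<And>y y' z. G y (z(t := y')) = G y z"
  shows "prob {z. G (z t) z} = (\<integral>y. prob {z. G y z} \<partial>measure_pmf q)"
proof -
  have "{(y, z). G y z} = (\<Union>y. {y} \<times> {z. G y z})" by auto
  also have "\<dots> \<in> sets (measure_pmf q \<Otimes>\<^sub>M \<Omega>)"
  proof -
    have "{y} \<times> {z. G y z} \<in> sets (measure_pmf q \<Otimes>\<^sub>M \<Omega>)" for y
      by (intro pair_measureI G) simp
    then show ?thesis by (intro sets.countable_UN') auto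
  qed
  finally have GS: "{(y, z). G y z} \<in> sets (measure_pmf q \<Otimes>\<^sub>M \<Omega>)" .
  have "emeasure \<Omega> {z. G (z t) z} = emeasure (distr (measure_pmf q \<Otimes>\<^sub>M \<Omega>) \<Omega> (\<lambda>(y, z). z(t := y))) {z. G (z t) z}"
    by (simp add: distr_resample)
  also have "\<dots> = emeasure (measure_pmf q \<Otimes>\<^sub>M \<Omega>) ((\<lambda>(y, z). z(t := y)) -` {z. G (z t) z} \<inter> space (measure_pmf q \<Otimes>\<^sub>M \<Omega>))"
    by (rule emeasure_distr[OF resample_measurable coordinate_event[OF G]])
  also have "(\<lambda>(y, z). z(t := y)) -` {z. G (z t) z} \<inter> space (measure_pmf q \<Otimes>\<^sub>M \<Omega>) = {(y, z). G y z}"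
    using indep by (auto simp: space_pair_measure)
  also have "emeasure (measure_pmf q \<Otimes>\<^sub>M \<Omega>) {(y, z). G y z} = (\<integral>\<^sup>+y. emeasure \<Omega> {z. G y z} \<partial>measure_pmf q)"
    unfolding emeasure_pair_measure_alt[OF GS] by (rule nn_integral_cong) (auto intro!: arg_cong2[where f = emeasure])
  also have "\<dots> = (\<integral>\<^sup>+y. ennreal (prob {z. G y z}) \<partial>measure_pmf q)" by (simp add: emeasure_eq_measure)
  also have "\<dots> = ennreal (\<integral>y. prob {z. G y z} \<partial>measure_pmf q)"
    by (intro nn_integral_eq_integral measure_pmf.integrable_const_bound[where B = 1]) auto
  finally have "ennreal (prob {z. G (z t) z}) = ennreal (\<integral>y. prob {z. G y z} \<partial>measure_pmf q)"
    by (simp add: emeasure_eq_measure)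
  then show ?thesis by (simp add: integral_nonneg)
qed

end

text \<open>
  Decoding a geometric variable reaches every element of a countable type.
\<close>

lemma ex_full_support_pmf: "\<exists>q :: 'b::countable pmf. set_pmf q = UNIV"
  by (rule exI[of _ "map_pmf from_nat (geometric_pmf (1/2))"]) (simp add: set_pmf_geometric surj_from_nat)

section \<open>Processes that copy their own past\<close>

text \<open>
  The instruction \<open>Inl a\<close> at time \<open>t\<close> emits the symbol \<open>a\<close>. The instruction \<open>Inr k\<close> copies the symbol
  emitted \<open>k + 1\<close> steps earlier if \<open>k \<in> S\<close>, and emits \<open>c\<close> otherwise. The number \<open>n\<close> bounds the length of the
  chain of copies that is followed.
\<close>

primrec copied :: "'a \<Rightarrow> nat set \<Rightarrow> nat \<Rightarrow> (int \<Rightarrow> 'a + nat) \<Rightarrow> int \<Rightarrow> 'a option" where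
  "copied c S 0 z t = None"
| "copied c S (Suc n) z t = (case z t of Inl a \<Rightarrow> Some a
     | Inr k \<Rightarrow> if k \<in> S then copied c S n z (t - 1 - int k) else Some c)"

text \<open>
  An endless chain of copies also yields \<open>c\<close>; so the recursion \<open>copying_rec\<close> holds for all
  instruction sequences, without an exceptional null set.
\<close>

definition copying :: "'a \<Rightarrow> nat set \<Rightarrow> (int \<Rightarrow> 'a + nat) \<Rightarrow> int \<Rightarrow> 'a" where
  "copying c S z t = (if \<exists>n. copied c S n z t \<noteq> None
     then the (copied c S (LEAST n. copied c S n z t \<noteq> None) z t) else c)"

lemma copied_Suc: "copied c S n z t = Some a \<Longrightarrow> copied c S (Suc n) z t = Some a"
proof (induction n arbitrary: t)
  case (Suc n)
  show ?case
  proof (cases "\<exists>k. z t = Inr k \<and> k \<in> S")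
    case True
    then obtain k where k: "z t = Inr k" "k \<in> S" by blast
    then have "copied c S (Suc n) z (t - 1 - int k) = Some a" using Suc by simp
    then show ?thesis using k by (subst copied.simps(2)) (simp del: copied.simps)
  next
    case False
    then show ?thesis using Suc.prems by (cases "z t") auto
  qed
qed simp

lemma copied_mono: "m \<le> n \<Longrightarrow> copied c S m z t = Some a \<Longrightarrow> copied c S n z t = Some a"
  by (induction n rule: dec_induct) (auto intro: copied_Suc simp del: copied.simps)

lemma copying_eqI:
  assumes "copied c S n z t = Some a" shows "copying c S z t = a"
proof -
  let ?l = "LEAST n. copied c S n z t \<noteq> None"
  have "copied c S ?l z t \<noteq> None" by (rule LeastI[of _ n]) (use assms in simp)
  then obtain b where b: "copied c S ?l z t = Some b" by auto
  have "?l \<le> n" by (rule Least_le) (use assms in simp)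
  from copied_mono[OF this b] have "b = a" using assms by simp
  moreover have "\<exists>n. copied c S n z t \<noteq> None" using assms by (intro exI[of _ n]) simp
  ultimately show ?thesis by (simp only: copying_def b if_True option.sel)
qed

lemma copying_rec:
  "copying c S z t = (case z t of Inl a \<Rightarrow> a
     | Inr k \<Rightarrow> if k \<in> S then copying c S z (t - 1 - int k) else c)"
proof (cases "z t")
  case (Inl a)
  then show ?thesis using copying_eqI[of c S "Suc 0" z t a] by simp
next
  case (Inr k)
  show ?thesis
  proof (cases "k \<in> S")
    case False
    then show ?thesis using copying_eqI[of c S "Suc 0" z t c] Inr by simp
  next
    case True
    show ?thesis
    proof (cases "\<exists>n. copied c S n z (t - 1 - int k) \<noteq> None")
      case some: True
      then obtain n a where a: "copied c S n z (t - 1 - int k) = Some a" by auto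
      then have "copied c S (Suc n) z t = Some a" using True Inr by simp
      from copying_eqI[OF this] show ?thesis using copying_eqI[OF a] True Inr by simp
    next
      case none: False
      then have "copied c S n z t = None" for n using True Inr by (cases n) auto
      then show ?thesis using none True Inr by (simp add: copying_def)
    qed
  qed
qed

lemma copied_left_shift: "copied c S n (left_shift z) t = copied c S n z (t + 1)"
proof (induction n arbitrary: t)
  case (Suc n)
  have "t - 1 - int k + 1 = t + 1 - 1 - int k" for k by simp
  then show ?case by (cases "z (t + 1)") (simp_all add: Suc left_shift_def[of z t])
qed simp

lemma copying_left_shift: "copying c S (left_shift z) = left_shift (copying c S z)"
  by (rule ext) (simp add: copying_def copied_left_shift left_shift_def)

lemma copied_update_later: "t < s \<Longrightarrow> copied c S n (z(s := y)) t = copied c S n z t"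
  by (induction n arbitrary: t) (auto split: sum.splits)

lemma copying_update_later: "t < s \<Longrightarrow> copying c S (z(s := y)) t = copying c S z t"
  by (simp add: copying_def copied_update_later)

text \<open>
  The chain of references from \<open>t\<close>, followed whether or not the references are enabled, ends within
  \<open>n\<close> steps and uses only references in \<open>B\<close>.
\<close>

primrec resolved :: "nat set \<Rightarrow> nat \<Rightarrow> (int \<Rightarrow> 'a + nat) \<Rightarrow> int \<Rightarrow> bool" where
  "resolved B 0 z t = False"
| "resolved B (Suc n) z t = (case z t of Inl a \<Rightarrow> True
     | Inr k \<Rightarrow> k \<in> B \<and> resolved B n z (t - 1 - int k))"

lemma resolved_mono: "resolved B n z t \<Longrightarrow> B \<subseteq> B' \<Longrightarrow> resolved B' n z t"
  by (induction n arbitrary: t) (auto split: sum.splits)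

lemma resolved_update_later: "t < s \<Longrightarrow> resolved B n (z(s := y)) t = resolved B n z t"
  by (induction n arbitrary: t) (auto split: sum.splits)

lemma resolved_bounded: "resolved UNIV n z t \<Longrightarrow> \<exists>k. resolved {..<k} n z t"
proof (induction n arbitrary: t)
  case (Suc n)
  show ?case
  proof (cases "z t")
    case (Inr j)
    then obtain k where k: "resolved {..<k} n z (t - 1 - int j)" using Suc by auto
    then have "resolved {..<max k (Suc j)} n z (t - 1 - int j)" by (rule resolved_mono) auto
    then show ?thesis using Inr by (intro exI[of _ "max k (Suc j)"]) simp
  qed auto
qed simp

text \<open>
  The chain that \<open>copying\<close> follows for \<open>S\<close> is an initial piece of the full chain of references, so
  \<open>S\<close> enters only through \<open>S \<inter> B\<close>.
\<close>

lemma copying_eq_if_resolved: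
  "resolved B n z t \<Longrightarrow> S \<inter> B = S' \<inter> B \<Longrightarrow> copying c S z t = copying c S' z t"
proof (induction n arbitrary: t)
  case (Suc n)
  show ?case
  proof (cases "z t")
    case (Inl a)
    then show ?thesis by (simp add: copying_rec[of c _ z t])
  next
    case (Inr k)
    then have k: "k \<in> B" "resolved B n z (t - 1 - int k)" using Suc.prems by auto
    then have "k \<in> S \<longleftrightarrow> k \<in> S'" using Suc.prems by blast
    then show ?thesis
      using Suc.IH[OF k(2) Suc.prems(2)] Inr by (simp add: copying_rec[of c _ z t])
  qed
qed simp

lemma past_is_nth: "past_is w \<omega> \<Longrightarrow> k < length w \<Longrightarrow> \<omega> (- 1 - int k) = rev w ! k"
proof -
  assume w: "past_is w \<omega>" and k: "k < length w"
  have "rev w ! k = w ! (length w - Suc k)" using k by (rule rev_nth)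
  also have "\<dots> = map \<omega> [- int (length w)..- 1] ! (length w - Suc k)" using w by (simp add: past_is_def)
  also have "\<dots> = \<omega> (- int (length w) + int (length w - Suc k))" using k by (simp add: nth_upto)
  also have "- int (length w) + int (length w - Suc k) = - 1 - int k" using k by linarith
  finally show ?thesis by simp
qed

lemma past_is_cong:
  assumes "\<And>i. i < 0 \<Longrightarrow> \<omega> i = \<omega>' i" shows "past_is w \<omega> = past_is w \<omega>'"
proof -
  have eq: "map \<omega> [- int (length w)..- 1] = map \<omega>' [- int (length w)..- 1]"
    by (rule map_cong) (use assms in auto)
  show ?thesis unfolding past_is_def eq ..
qed

lemma Inr_in_image_iff [simp]: "Inr k \<in> Inr ` A \<longleftrightarrow> k \<in> A"
  by auto

text \<open>
  One sequence of instructions drives the processes for all \<open>S\<close> at once, which couples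
  their laws.
\<close>

locale copying_process = iid_process q for q :: "('a::finite + nat) pmf" +
  fixes c :: 'a
  assumes full_support: "set_pmf q = UNIV"
begin

lemma UNIV_event [simp]: "UNIV \<in> events"
  using sets.top[of \<Omega>] by simp

lemma copied_event: "{z. copied c S n z t = x} \<in> events"
proof (induction n arbitrary: t)
  case 0
  then show ?case by simp
next
  case (Suc n)
  have "{z. (case y of Inl a \<Rightarrow> Some a
     | Inr k \<Rightarrow> if k \<in> S then copied c S n z (t - 1 - int k) else Some c) = x} \<in> events" for y
  proof (cases y)
    case (Inr k)
    then show ?thesis using Suc by (cases "k \<in> S") simp_all
  qed simp
  from coordinate_event[OF this] show ?case by simp
qed

lemma copying_event: "{z. copying c S z t = a} \<in> events"
proof -
  have "{z. copying c S z t = a} = (\<Union>n. {z. copied c S n z t = Some a}) \<union>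
      (if a = c then (\<Inter>n. {z. copied c S n z t = None}) else {})" (is "?L = ?R")
  proof (intro set_eqI)
    fix z
    show "z \<in> ?L \<longleftrightarrow> z \<in> ?R"
    proof (cases "\<exists>n b. copied c S n z t = Some b")
      case True
      then obtain n b where b: "copied c S n z t = Some b" by blast
      then have X: "copying c S z t = b" by (rule copying_eqI)
      have "(\<exists>m. copied c S m z t = Some a) \<longleftrightarrow> b = a"
        using b X copying_eqI by metis
      moreover have "\<not> (\<forall>n. copied c S n z t = None)"
        using b by (metis option.distinct(1))
      ultimately show ?thesis using X by auto
    next
      case False
      then have "copied c S n z t = None" for n by (metis option.exhaust)
      then show ?thesis by (auto simp: copying_def)
    qed
  qed
  also have "\<dots> \<in> events" using copied_event by auto
  finally show ?thesis .
qed

lemma copying_measurable [measurable]: "copying c S \<in> \<Omega> \<rightarrow>\<^sub>M seq_space"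
  unfolding seq_space_def
proof (rule measurable_PiM_single')
  show "(\<lambda>z. copying c S z t) \<in> \<Omega> \<rightarrow>\<^sub>M count_space UNIV" for t
    by (subst measurable_count_space_eq2) (auto simp: vimage_def copying_event)
qed auto

definition law :: "nat set \<Rightarrow> (int \<Rightarrow> 'a) measure" where
  "law S = distr \<Omega> seq_space (copying c S)"

lemma measure_law:
  "{\<omega>. Q \<omega>} \<in> sets seq_space \<Longrightarrow> measure (law S) {\<omega>. Q \<omega>} = prob {z. Q (copying c S z)}"
  unfolding law_def by (subst measure_distr) (auto simp: vimage_def)

text \<open>
  The map from instructions to symbols commutes with the shift, so the law is a factor of an ergodic
  system.
\<close>

lemma law_stationary_ergodic: "law S \<in> stationary_ergodic"
  unfolding stationary_ergodic_def
proof (intro CollectI conjI ballI impI)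
  have ls: "left_shift \<in> seq_space \<rightarrow>\<^sub>M (seq_space :: (int \<Rightarrow> 'a) measure)"
    unfolding seq_space_def by (rule measurable_PiM_single') (auto simp: left_shift_def)
  show "prob_space (law S)" unfolding law_def by (rule prob_space_distr) simp
  show sets: "sets (law S) = sets seq_space" by (simp add: law_def)
  have "distr (law S) seq_space left_shift = distr \<Omega> seq_space (left_shift \<circ> copying c S)"
    unfolding law_def by (rule distr_distr[OF ls]) simp
  also have "left_shift \<circ> copying c S = copying c S \<circ> left_shift"
    by (simp add: fun_eq_iff copying_left_shift)
  also have "distr \<Omega> seq_space (copying c S \<circ> left_shift) = distr (distr \<Omega> \<Omega> left_shift) seq_space (copying c S)"
    by (rule distr_distr[symmetric]) auto
  also have "\<dots> = law S" by (simp add: left_shift_invariant law_def)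
  finally show "distr (law S) (law S) left_shift = law S"
    using distr_cong[of "law S" "law S" "law S" seq_space] sets by simp
  fix E assume E: "E \<in> sets (law S)" "left_shift -` E = E"
  have E': "copying c S -` E \<in> events"
    using measurable_sets[OF copying_measurable, of E S] E(1) sets by simp
  have "left_shift -` (copying c S -` E) = copying c S -` (left_shift -` E)"
    by (simp add: vimage_def copying_left_shift)
  then have "prob (copying c S -` E) = 0 \<or> prob (copying c S -` E) = 1"
    using invariant_trivial[OF E'] E(2) by simp
  moreover have "measure (law S) E = prob (copying c S -` E)"
    unfolding law_def by (subst measure_distr) (use E(1) sets in auto)
  ultimately show "measure (law S) E = 0 \<or> measure (law S) E = 1" by simp
qed

sublocale P: ergodic_process "law S" for S
  by unfold_locales (rule law_stationary_ergodic)

lemma past_copying_event: "{z. past_is w (copying c S z)} \<in> events"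
proof -
  have "{\<omega> :: int \<Rightarrow> 'a. past_is w \<omega>} \<in> sets seq_space"
    unfolding past_is_def by (rule finite_window_sets)
  from measurable_sets[OF copying_measurable this] show ?thesis by (simp add: vimage_def)
qed

lemma string_prob_law: "string_prob (law S) w = prob {z. past_is w (copying c S z)}"
  unfolding P.string_prob_eq past_is_def by (rule measure_law[OF finite_window_sets])

text \<open>
  The instructions may spell out any string symbol by symbol.
\<close>

lemma string_prob_law_pos: "string_prob (law S) w > 0"
proof -
  define J where "J = {- int (length w)..-1}"
  define E where "E i = {Inl (w ! nat (i + int (length w))) :: 'a + nat}" for i
  have "0 < (\<Prod>i\<in>J. pmf q (Inl (w ! nat (i + int (length w)))))"
    by (rule prod_pos) (use full_support in \<open>simp add: pmf_positive_iff\<close>)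
  also have "\<dots> = prob (box J E)"
    by (subst prob_box) (auto simp: J_def E_def measure_pmf_single)
  also have "\<dots> \<le> prob {z. past_is w (copying c S z)}"
  proof (rule finite_measure_mono[OF _ past_copying_event], rule subsetI)
    fix z assume z: "z \<in> box J E"
    have "map (copying c S z) [- int (length w)..- 1] = w"
    proof (rule nth_equalityI)
      fix i assume "i < length (map (copying c S z) [- int (length w)..- 1])"
      then have i: "i < length w" by simp
      have "z (- int (length w) + int i) = Inl (w ! i)"
        using z i unfolding box_def J_def E_def by auto
      then have "copying c S z (- int (length w) + int i) = w ! i"
        by (subst copying_rec) (simp only: sum.case)
      then show "map (copying c S z) [- int (length w)..- 1] ! i = w ! i"
        using i by (simp add: nth_upto)
    qed simp
    then show "z \<in> {z. past_is w (copying c S z)}" by (simp add: past_is_def)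
  qed
  finally show ?thesis by (simp add: string_prob_law)
qed

definition next_symbol :: "nat set \<Rightarrow> 'a + nat \<Rightarrow> (int \<Rightarrow> 'a) \<Rightarrow> 'a" where
  "next_symbol S y \<omega> = (case y of Inl b \<Rightarrow> b | Inr k \<Rightarrow> if k \<in> S then \<omega> (- 1 - int k) else c)"

text \<open>
  The conditional probability of the next symbol \<open>a\<close>, given the past \<open>w\<close> and the present
  instruction \<open>y\<close>.
\<close>

definition next_weight :: "nat set \<Rightarrow> 'a list \<Rightarrow> 'a \<Rightarrow> 'a + nat \<Rightarrow> real" where
  "next_weight S w a y = prob {z. past_is w (copying c S z) \<and> next_symbol S y (copying c S z) = a}
     / string_prob (law S) w"

lemma next_symbol_event: "{z. past_is w (copying c S z) \<and> next_symbol S y (copying c S z) = a} \<in> events"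
proof -
  have "{z. next_symbol S y (copying c S z) = a} \<in> events"
  proof (cases y)
    case (Inr k)
    then show ?thesis
      using copying_event by (cases "k \<in> S") (simp_all add: next_symbol_def)
  qed (simp add: next_symbol_def)
  from sets.Int[OF past_copying_event[of w S] this] show ?thesis by (simp add: Collect_conj_eq)
qed

lemma next_weight_bounds: "0 \<le> next_weight S w a y" "next_weight S w a y \<le> 1"
proof -
  have "prob {z. past_is w (copying c S z) \<and> next_symbol S y (copying c S z) = a} \<le> string_prob (law S) w"
    unfolding string_prob_law by (rule finite_measure_mono[OF _ past_copying_event]) auto
  then show "0 \<le> next_weight S w a y" "next_weight S w a y \<le> 1"
    using string_prob_law_pos[of S w] by (auto simp: next_weight_def divide_le_eq_1)
qed

lemma next_prob_law: "next_prob (law S) a w = (\<integral>y. next_weight S w a y \<partial>measure_pmf q)"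
proof -
  have "string_prob (law S) (w @ [a]) = prob {z. past_is w (copying c S z) \<and> copying c S z 0 = a}"
    unfolding P.string_prob_snoc
    by (rule measure_law) (use P.snoc_event[of w a S] P.sets_P[of S] in simp)
  also have "\<dots> = prob {z. past_is w (copying c S z) \<and> next_symbol S (z 0) (copying c S z) = a}"
  proof -
    have "copying c S z 0 = next_symbol S (z 0) (copying c S z)" for z
      by (subst copying_rec) (cases "z 0", simp_all add: next_symbol_def)
    then show ?thesis by simp
  qed
  also have "\<dots> = (\<integral>y. prob {z. past_is w (copying c S z) \<and> next_symbol S y (copying c S z) = a} \<partial>measure_pmf q)"
  proof (rule prob_resample[OF next_symbol_event])
    fix y y' z
    have "past_is w (copying c S (z(0 := y'))) = past_is w (copying c S z)"
      by (rule past_is_cong) (simp add: copying_update_later)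
    moreover have "next_symbol S y (copying c S (z(0 := y'))) = next_symbol S y (copying c S z)"
      by (cases y) (auto simp: next_symbol_def copying_update_later)
    ultimately show "(past_is w (copying c S (z(0 := y'))) \<and> next_symbol S y (copying c S (z(0 := y'))) = a)
        = (past_is w (copying c S z) \<and> next_symbol S y (copying c S z) = a)" by simp
  qed
  finally show ?thesis by (simp add: P.next_prob_eq next_weight_def)
qed

text \<open>
  Only an enabled reference beyond the known past \<open>w\<close> leaves the next symbol open.
\<close>

lemma next_weight_decided:
  assumes "y \<notin> Inr ` (S \<inter> {length w..})"
  shows "next_weight S w a y = of_bool ((case y of Inl b \<Rightarrow> b | Inr k \<Rightarrow> if k \<in> S then rev w ! k else c) = a)"
    (is "_ = of_bool (?s = a)")
proof -
  have "next_symbol S y \<omega> = ?s" if "past_is w \<omega>" for \<omega>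
    using assms past_is_nth[OF that] by (cases y) (auto simp: next_symbol_def)
  then have "{z. past_is w (copying c S z) \<and> next_symbol S y (copying c S z) = a}
      = (if ?s = a then {z. past_is w (copying c S z)} else {})" by auto
  then show ?thesis
    using string_prob_law_pos[of S w] by (simp add: next_weight_def string_prob_law)
qed

lemma next_weight_suffix:
  assumes "y \<notin> Inr ` (S \<inter> {length u..})" "suffix u w"
  shows "next_weight S w a y = next_weight S u a y"
proof -
  obtain v where w: "w = v @ u" using assms(2) by (auto simp: suffix_def)
  have y: "y \<notin> Inr ` (S \<inter> {length w..})" using assms(1) by (auto simp: w)
  show ?thesis
    unfolding next_weight_decided[OF y] next_weight_decided[OF assms(1)]
    using assms(1) by (cases y) (auto simp: w nth_append)
qed

lemma finite_memory_determines:
  assumes "S \<subseteq> {..<length v}" shows "determines_next (law S) v"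
  unfolding determines_next_def
proof (intro allI impI)
  fix a w assume "suffix v w"
  then have "next_weight S w a y = next_weight S v a y" for y
    by (rule next_weight_suffix[rotated]) (use assms in auto)
  then show "next_prob (law S) a w = next_prob (law S) a v" by (simp add: next_prob_law)
qed

lemma tail_weight_small:
  assumes "\<epsilon> > 0" shows "\<exists>M>k0. measure (measure_pmf q) (Inr ` {M..}) < \<epsilon>"
proof -
  have "(\<lambda>M. measure (measure_pmf q) (Inr ` {M..})) \<longlonglongrightarrow> measure (measure_pmf q) (\<Inter>M. Inr ` {M..})"
    by (rule measure_pmf.finite_Lim_measure_decseq) (auto simp: decseq_def)
  also have "(\<Inter>M::nat. Inr ` {M..}) = ({} :: ('a + nat) set)"
  proof -
    have "x \<notin> (\<Inter>M::nat. Inr ` {M..})" for x :: "'a + nat"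
    proof (cases x)
      case (Inr k)
      then have "x \<notin> Inr ` {Suc k..}" by auto
      then show ?thesis by blast
    qed auto
    then show ?thesis by blast
  qed
  finally have "(\<lambda>M. measure (measure_pmf q) (Inr ` {M..} :: ('a + nat) set)) \<longlonglongrightarrow> 0" by simp
  then have "eventually (\<lambda>M. measure (measure_pmf q) (Inr ` {M..} :: ('a + nat) set) < \<epsilon>) sequentially"
    by (rule order_tendstoD) (rule assms)
  with eventually_gt_at_top[of k0]
  have "eventually (\<lambda>M. M > k0 \<and> measure (measure_pmf q) (Inr ` {M..} :: ('a + nat) set) < \<epsilon>) sequentially"
    by eventually_elim simp
  from eventually_happens[OF this] show ?thesis by auto
qed

text \<open>
  Take an enabled reference \<open>k0\<close> that reaches beyond \<open>u\<close>, and extend \<open>u\<close> to length \<open>M > k0\<close>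
  by copies of \<open>a\<close> or by copies of \<open>b\<close>. The instruction \<open>Inr k0\<close> alone separates the conditional
  probabilities of \<open>a\<close> by its weight, while the references beyond \<open>M\<close> can offset at most their total
  weight, which is smaller if \<open>M\<close> is large.
\<close>

lemma infinite_memory_not_determines:
  assumes inf: "infinite S" and card: "CARD('a) \<ge> 2"
  shows "\<not> determines_next (law S) u"
proof
  assume det: "determines_next (law S) u"
  have "\<exists>a b :: 'a. a \<noteq> b"
  proof (rule ccontr)
    assume "\<not> ?thesis"
    then have "(UNIV :: 'a set) = {c}" by blast
    then have "CARD('a) = card {c}" by (rule arg_cong)
    then show False using card by simp
  qed
  then obtain a b :: 'a where ab: "a \<noteq> b" by blast
  define m where "m = length u"
  obtain k0 where k0: "k0 \<in> S" "k0 \<ge> m" using inf by (metis infinite_nat_iff_unbounded_le)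
  have "pmf q (Inr k0) > 0" using full_support by (simp add: pmf_positive_iff)
  then obtain M where M: "k0 < M" "measure (measure_pmf q) (Inr ` {M..}) < pmf q (Inr k0)"
    using tail_weight_small by blast
  define w1 w2 where "w1 = replicate (M - m) a @ u" and "w2 = replicate (M - m) b @ u"
  have len: "length w1 = M" "length w2 = M" using k0 M by (auto simp: w1_def w2_def m_def)
  have suf: "suffix u w1" "suffix u w2" by (auto simp: w1_def w2_def suffix_def)
  have nth: "rev w1 ! k = a" "rev w2 ! k = b" if "m \<le> k" "k < M" for k
    using that by (auto simp: w1_def w2_def m_def nth_append)
  \<comment> \<open>A pointwise lower bound, with positive mean, for the difference of the two conditional probabilities.\<close>
  let ?low = "\<lambda>y. indicator {Inr k0} y - indicator (Inr ` {M..}) y :: real"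
  have point: "?low y \<le> next_weight S w1 a y - next_weight S w2 a y" for y
  proof (cases "y \<in> Inr ` (S \<inter> {m..})")
    case False
    then have "y \<noteq> Inr k0" using k0 by auto
    moreover have "next_weight S w1 a y = next_weight S w2 a y"
      using next_weight_suffix[OF False[unfolded m_def] suf(1)]
        next_weight_suffix[OF False[unfolded m_def] suf(2)] by simp
    ultimately show ?thesis by (simp add: indicator_def)
  next
    case True
    then obtain k where k: "y = Inr k" "k \<in> S" "m \<le> k" by auto
    show ?thesis
    proof (cases "k < M")
      case True
      then have "y \<notin> Inr ` (S \<inter> {length w1..})" "y \<notin> Inr ` (S \<inter> {length w2..})"
        using k len by auto
      then have "next_weight S w1 a y = 1" "next_weight S w2 a y = 0"
        using k True ab nth[of k] by (auto simp: next_weight_decided)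
      then show ?thesis by (simp add: indicator_def)
    next
      case False
      then have "y \<noteq> Inr k0" "y \<in> Inr ` {M..}" using k M by auto
      then show ?thesis
        using next_weight_bounds[of S w1 a y] next_weight_bounds[of S w2 a y] by simp
    qed
  qed
  have int: "integrable (measure_pmf q) (next_weight S w a)" for w
    by (rule measure_pmf.integrable_const_bound[where B = 1]) (auto simp: next_weight_bounds)
  have int_indicator: "integrable (measure_pmf q) (indicator A :: _ \<Rightarrow> real)" for A
    by (auto intro!: measure_pmf.integrable_const_bound[where B = 1])
  have eq1: "(\<integral>y. ?low y \<partial>measure_pmf q) = pmf q (Inr k0) - measure (measure_pmf q) (Inr ` {M..})"
  proof -
    have "(\<integral>y. ?low y \<partial>measure_pmf q) = (\<integral>y. indicator {Inr k0} y \<partial>measure_pmf q)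
        - (\<integral>y. indicator (Inr ` {M..}) y \<partial>measure_pmf q)"
      by (rule Bochner_Integration.integral_diff) (rule int_indicator)+
    then show ?thesis by (simp add: measure_pmf_single)
  qed
  have eq2: "(\<integral>y. next_weight S w1 a y - next_weight S w2 a y \<partial>measure_pmf q)
      = next_prob (law S) a w1 - next_prob (law S) a w2"
    unfolding next_prob_law by (rule Bochner_Integration.integral_diff) (rule int)+
  have "(\<integral>y. ?low y \<partial>measure_pmf q)
      \<le> (\<integral>y. next_weight S w1 a y - next_weight S w2 a y \<partial>measure_pmf q)"
  proof (rule integral_mono)
    show "integrable (measure_pmf q) ?low"
      by (rule Bochner_Integration.integrable_diff) (rule int_indicator)+
    show "integrable (measure_pmf q) (\<lambda>y. next_weight S w1 a y - next_weight S w2 a y)"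
      by (rule Bochner_Integration.integrable_diff) (rule int)+
  qed (rule point)
  moreover have "next_prob (law S) a w1 = next_prob (law S) a u"
    using det suf(1) string_prob_law_pos[of S w1] unfolding determines_next_def by blast
  moreover have "next_prob (law S) a w2 = next_prob (law S) a u"
    using det suf(2) string_prob_law_pos[of S w2] unfolding determines_next_def by blast
  ultimately show False using M(2) unfolding eq1 eq2 by linarith
qed

lemma nodes_finite_memory:
  assumes "finite S" shows "finite (nodes (context_tree (law S)))"
proof -
  obtain j where j: "S \<subseteq> {..<j}" using assms finite_nat_iff_bounded by auto
  have "length v \<le> j" if "P.node S v" for v
  proof (rule ccontr)
    assume "\<not> length v \<le> j"
    then have len: "length (drop (length v - j) v) = j" by simp
    have "determines_next (law S) (drop (length v - j) v)"
      by (rule finite_memory_determines) (use j len in simp)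
    moreover have "drop (length v - j) v \<noteq> v"
    proof
      assume "drop (length v - j) v = v"
      then have "length v = j" using len by metis
      then show False using \<open>\<not> length v \<le> j\<close> by simp
    qed
    then have "strict_suffix (drop (length v - j) v) v"
      by (simp add: strict_suffix_def suffix_drop)
    ultimately show False using that by (auto simp: P.node_def)
  qed
  then have "nodes (context_tree (law S)) \<subseteq> {v. length v \<le> j}"
    unfolding P.nodes_context_tree by auto
  then show ?thesis
    using finite_lists_length_le[of "UNIV :: 'a set" j] by (auto intro: finite_subset)
qed

lemma nodes_infinite_memory:
  assumes "infinite S" "CARD('a) \<ge> 2" shows "nodes (context_tree (law S)) = UNIV"
  unfolding P.nodes_context_tree
  using infinite_memory_not_determines[OF assms] string_prob_law_pos by (auto simp: P.node_def)

lemma resolved_event: "{z. resolved B n z t} \<in> events"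
proof (induction n arbitrary: t)
  case (Suc n)
  have "{z. (case y of Inl a \<Rightarrow> True | Inr k \<Rightarrow> k \<in> B \<and> resolved B n z (t - 1 - int k))} \<in> events" for y
  proof (cases y)
    case (Inr k)
    then show ?thesis using Suc by (cases "k \<in> B") simp_all
  qed simp
  from coordinate_event[OF this] show ?case by simp
qed simp

lemma unresolved_event: "{z. \<not> resolved B n z t} \<in> events"
  using sets.compl_sets[OF resolved_event[of B n t]] by (simp add: Compl_eq_Diff_UNIV[symmetric] Collect_neg_eq)

text \<open>
  The instruction at \<open>t\<close> is independent of the earlier ones, so each further step of the chain costs a
  factor, the probability of a reference.
\<close>

lemma prob_unresolved: "prob {z. \<not> resolved UNIV n z t} \<le> measure (measure_pmf q) (range Inr) ^ n"
proof (induction n arbitrary: t)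
  case 0
  then show ?case by simp
next
  case (Suc n)
  define \<rho> where "\<rho> = measure (measure_pmf q) (range Inr)"
  define G where "G y z = (case y of Inl a \<Rightarrow> False | Inr k \<Rightarrow> \<not> resolved UNIV n z (t - 1 - int k))"
    for y :: "'a + nat" and z :: "int \<Rightarrow> 'a + nat"
  have G: "{z. G y z} \<in> events" for y
    using unresolved_event by (cases y) (auto simp: G_def)
  have bound: "prob {z. G y z} \<le> \<rho> ^ n * indicator (range Inr) y" for y
    using Suc by (cases y) (auto simp: G_def \<rho>_def)
  have "prob {z. \<not> resolved UNIV (Suc n) z t} = prob {z. G (z t) z}"
    by (rule arg_cong[where f = prob]) (auto simp: G_def split: sum.splits)
  also have "\<dots> = (\<integral>y. prob {z. G y z} \<partial>measure_pmf q)"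
    by (rule prob_resample[OF G]) (auto simp: G_def resolved_update_later split: sum.splits)
  also have "\<dots> \<le> (\<integral>y. \<rho> ^ n * indicator (range Inr) y \<partial>measure_pmf q)"
    by (rule integral_mono)
       (use bound in \<open>auto intro!: measure_pmf.integrable_const_bound[where B = 1]\<close>)
  also have "\<dots> = \<rho> ^ Suc n" by (simp add: \<rho>_def)
  finally show ?case by (simp add: \<rho>_def)
qed

lemma AE_resolved: "AE z in \<Omega>. \<exists>n. resolved UNIV n z t"
proof -
  define \<rho> where "\<rho> = measure (measure_pmf q) (range Inr :: ('a + nat) set)"
  have "pmf q (Inl c) > 0" using full_support by (simp add: pmf_positive_iff)
  also have "pmf q (Inl c) \<le> measure (measure_pmf q) (UNIV - range Inr)"
    unfolding measure_pmf_single[symmetric] by (rule measure_pmf.finite_measure_mono) auto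
  also have "\<dots> = 1 - \<rho>"
    using measure_pmf.prob_compl[of "range Inr" q] by (simp add: \<rho>_def)
  finally have \<rho>: "\<rho> < 1" by simp
  have ev: "{z. \<forall>n. \<not> resolved UNIV n z t} \<in> events"
  proof -
    have eq: "{z. \<forall>n. \<not> resolved UNIV n z t} = (\<Inter>n. {z. \<not> resolved UNIV n z t})" by auto
    show ?thesis unfolding eq using unresolved_event by auto
  qed
  have "prob {z. \<forall>n. \<not> resolved UNIV n z t} \<le> \<rho> ^ n" for n
  proof -
    have "prob {z. \<forall>n. \<not> resolved UNIV n z t} \<le> prob {z. \<not> resolved UNIV n z t}"
      by (rule finite_measure_mono[OF _ unresolved_event]) auto
    then show ?thesis using prob_unresolved[of n t] by (simp add: \<rho>_def)
  qed
  moreover have "(\<lambda>n. \<rho> ^ n) \<longlonglongrightarrow> 0"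
    by (rule LIMSEQ_power_zero) (use \<rho> in \<open>simp add: \<rho>_def\<close>)
  ultimately have "prob {z. \<forall>n. \<not> resolved UNIV n z t} \<le> 0"
    by (intro LIMSEQ_le_const) auto
  then have "prob {z. \<forall>n. \<not> resolved UNIV n z t} = 0" by (simp add: measure_le_0_iff)
  then have "AE z in \<Omega>. z \<notin> {z. \<forall>n. \<not> resolved UNIV n z t}" using ev by (simp add: prob_eq_0)
  then show ?thesis by simp
qed

text \<open>
  The event that some symbol of a sample of size \<open>n\<close> might depend on whether a reference that is at least
  \<open>k\<close> is enabled.
\<close>

definition unresolved_sample :: "nat \<Rightarrow> nat \<Rightarrow> (int \<Rightarrow> 'a + nat) set" where
  "unresolved_sample n k = {z. \<exists>t\<in>{1..int n}. \<forall>m. \<not> resolved {..<k} m z t}"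

lemma unresolved_sample_event: "unresolved_sample n k \<in> events"
proof -
  have "unresolved_sample n k = (\<Union>t\<in>{1..int n}. \<Inter>m. {z. \<not> resolved {..<k} m z t})"
    by (auto simp: unresolved_sample_def)
  then show ?thesis using unresolved_event by (auto intro!: sets.finite_UN)
qed

lemma unresolved_sample_vanishes: "(\<lambda>k. prob (unresolved_sample n k)) \<longlonglongrightarrow> 0"
proof -
  have "AE z in \<Omega>. \<forall>t. \<exists>m. resolved UNIV m z t"
    unfolding AE_all_countable using AE_resolved by blast
  then have "AE z in \<Omega>. eventually (\<lambda>k. \<not> (z \<in> unresolved_sample n k)) sequentially"
  proof eventually_elim
    fix z :: "int \<Rightarrow> 'a + nat" assume "\<forall>t. \<exists>m. resolved UNIV m z t"
    then have "\<forall>t. \<exists>m k. resolved {..<k} m z t" using resolved_bounded by blast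
    then obtain m k where mk: "\<And>t. resolved {..<k t} (m t) z t" by metis
    have "eventually (\<lambda>K. \<forall>t\<in>{1..int n}. k t \<le> K) sequentially"
      by (rule eventually_ball_finite) (auto intro: eventually_ge_at_top)
    then show "eventually (\<lambda>k. \<not> (z \<in> unresolved_sample n k)) sequentially"
    proof eventually_elim
      fix K assume K: "\<forall>t\<in>{1..int n}. k t \<le> K"
      have "resolved {..<K} (m t) z t" if "t \<in> {1..int n}" for t
        by (rule resolved_mono[OF mk]) (use K that in auto)
      then show "\<not> (z \<in> unresolved_sample n K)"
        unfolding unresolved_sample_def by blast
    qed
  qed
  from AE_eventually_imp_prob_tendsto_0[OF _ this] show ?thesis
    using unresolved_sample_event by simp
qed

lemma sample_eq_if_resolved:
  assumes "z \<notin> unresolved_sample n k" "S \<inter> {..<k} = S' \<inter> {..<k}"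
  shows "map (copying c S z) [1..int n] = map (copying c S' z) [1..int n]"
proof (rule map_cong[OF refl])
  fix t assume "t \<in> set [1..int n]"
  then have "t \<in> {1..int n}" by simp
  then obtain m where "resolved {..<k} m z t"
    using assms(1) unfolding unresolved_sample_def by blast
  then show "copying c S z t = copying c S' z t" using assms(2) by (rule copying_eq_if_resolved)
qed

end

section \<open>Non-summable weights: no consistent estimator\<close>

text \<open>
  The distance to the empty tree is the total weight of the nodes; through the triangle inequality, a
  tree of finite weight is at infinite distance from a tree of infinite weight.
\<close>

lemma hamming_dist_triangle:
  assumes "\<And>v. \<phi> v \<ge> 0"
  shows "hamming_dist \<phi> \<tau> \<tau>'' \<le> hamming_dist \<phi> \<tau> \<tau>' + hamming_dist \<phi> \<tau>' \<tau>''"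
proof -
  let ?d = "\<lambda>\<tau> \<tau>' v. ennreal (\<phi> v * \<bar>indicator (nodes \<tau>) v - indicator (nodes \<tau>') v\<bar>)"
  have summ: "f summable_on A" for f :: "'a list \<Rightarrow> ennreal" and A
    by (rule nonneg_summable_on_complete) simp
  have "hamming_dist \<phi> \<tau> \<tau>'' \<le> (\<Sum>\<^sub>\<infinity>v\<in>UNIV. ?d \<tau> \<tau>' v + ?d \<tau>' \<tau>'' v)"
    unfolding hamming_dist_def
  proof (rule infsum_mono[OF summ summ])
    fix v :: "'a list"
    have "\<phi> v * \<bar>indicator (nodes \<tau>) v - indicator (nodes \<tau>'') v\<bar>
        \<le> \<phi> v * (\<bar>indicator (nodes \<tau>) v - indicator (nodes \<tau>') v\<bar> + \<bar>indicator (nodes \<tau>') v - indicator (nodes \<tau>'') v\<bar>)"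
      using assms by (intro mult_left_mono) auto
    then have "?d \<tau> \<tau>'' v \<le> ennreal (\<phi> v * \<bar>indicator (nodes \<tau>) v - indicator (nodes \<tau>') v\<bar>
        + \<phi> v * \<bar>indicator (nodes \<tau>') v - indicator (nodes \<tau>'') v\<bar>)"
      by (intro ennreal_leI) (simp add: distrib_left)
    also have "\<dots> = ?d \<tau> \<tau>' v + ?d \<tau>' \<tau>'' v"
      by (rule ennreal_plus) (use assms in auto)
    finally show "?d \<tau> \<tau>'' v \<le> ?d \<tau> \<tau>' v + ?d \<tau>' \<tau>'' v" .
  qed
  also have "\<dots> = hamming_dist \<phi> \<tau> \<tau>' + hamming_dist \<phi> \<tau>' \<tau>''"
    unfolding hamming_dist_def by (rule infsum_add[OF summ summ])
  finally show ?thesis .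
qed

lemma hamming_dist_sym: "hamming_dist \<phi> \<tau> \<tau>' = hamming_dist \<phi> \<tau>' \<tau>"
  unfolding hamming_dist_def by (simp add: abs_minus_commute)

lemma hamming_dist_empty_finite:
  assumes "finite (nodes \<tau>)" shows "hamming_dist \<phi> \<tau> {} < \<infinity>"
proof -
  have "hamming_dist \<phi> \<tau> {} = (\<Sum>\<^sub>\<infinity>v\<in>nodes \<tau>. ennreal (\<phi> v))"
    unfolding hamming_dist_def
    by (rule infsum_cong_neutral) (auto simp: nodes_def indicator_def)
  also have "\<dots> < \<infinity>" using assms by (simp add: less_top[symmetric])
  finally show ?thesis .
qed

lemma hamming_dist_empty_full:
  assumes "nodes \<tau> = UNIV" shows "hamming_dist \<phi> \<tau> {} = (\<Sum>\<^sub>\<infinity>v\<in>UNIV. ennreal (\<phi> v))"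
  unfolding hamming_dist_def assms by (rule infsum_cong) (simp add: nodes_def)

context copying_process
begin

lemma sample_event: "{z. F (map (copying c S z) [1..int n])} \<in> events"
  using measurable_sets[OF copying_measurable finite_window_sets[of F "[1..int n]"], of S]
  by (simp add: vimage_def)

lemma law_sample: "\<P>(\<omega> in law S. F (map \<omega> [1..int n])) = prob {z. F (map (copying c S z) [1..int n])}"
  by (simp add: measure_law[OF finite_window_sets])

text \<open>
  Call an estimate heavy if its nodes have infinite weight, and let \<open>h S n\<close> be the probability of a heavy
  estimate from a sample of size \<open>n\<close> under the law of \<open>S\<close>. Consistency forces \<open>h S\<close> to tend to 0 for finite \<open>S\<close>
  and to 1 for infinite \<open>S\<close>. An infinite \<open>S\<close> is built from finite sets \<open>A j\<close> with sample sizes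
  \<open>N j\<close> such that \<open>h (A j) (N j) < 1/4\<close>, where the elements added later are so large that they change
  the sample of size \<open>N j\<close> with probability below \<open>1/4\<close> only. So \<open>h S (N j) < 1/2\<close> for all \<open>j\<close>, a
  contradiction.
\<close>

lemma not_estimable:
  assumes \<phi>: "\<And>v. \<phi> v \<ge> 0" and card: "CARD('a) \<ge> 2"
    and divergent: "(\<Sum>\<^sub>\<infinity>v\<in>UNIV. ennreal (\<phi> v)) = \<infinity>"
    and cons: "\<And>S. (\<lambda>n. \<P>(\<omega> in law S. hamming_dist \<phi> (T_est n (map \<omega> [1..int n])) (context_tree (law S)) > ennreal 1)) \<longlonglongrightarrow> 0"
  shows False
proof -
  define heavy where "heavy n x \<longleftrightarrow> hamming_dist \<phi> (T_est n x) {} = \<infinity>" for n x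
  define h where "h S n = prob {z. heavy n (map (copying c S z) [1..int n])}" for S n
  have h_finite: "h S \<longlonglongrightarrow> 0" if "finite S" for S
  proof (rule tendsto_sandwich[OF _ _ tendsto_const cons[of S]])
    have "{z. heavy n (map (copying c S z) [1..int n])} \<subseteq>
        {z. hamming_dist \<phi> (T_est n (map (copying c S z) [1..int n])) (context_tree (law S)) > ennreal 1}" for n
    proof clarify
      fix z assume "heavy n (map (copying c S z) [1..int n])"
      then have "\<infinity> \<le> hamming_dist \<phi> (T_est n (map (copying c S z) [1..int n])) (context_tree (law S))
          + hamming_dist \<phi> (context_tree (law S)) {}"
        using hamming_dist_triangle[of \<phi> "T_est n (map (copying c S z) [1..int n])" "{}" "context_tree (law S)"] \<phi>
        unfolding heavy_def by simp
      moreover have "hamming_dist \<phi> (context_tree (law S)) {} < \<infinity>"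
        by (rule hamming_dist_empty_finite) (rule nodes_finite_memory[OF that])
      ultimately have "hamming_dist \<phi> (T_est n (map (copying c S z) [1..int n])) (context_tree (law S)) = \<infinity>"
        by (simp add: top_unique less_top[symmetric])
      then show "ennreal 1 < hamming_dist \<phi> (T_est n (map (copying c S z) [1..int n])) (context_tree (law S))"
        by simp
    qed
    then show "eventually (\<lambda>n. h S n \<le> \<P>(\<omega> in law S. hamming_dist \<phi> (T_est n (map \<omega> [1..int n])) (context_tree (law S)) > ennreal 1)) sequentially"
      unfolding h_def law_sample[where F = "\<lambda>x. hamming_dist \<phi> (T_est n x) (context_tree (law S)) > ennreal 1" and n = n for n]
      by (intro always_eventually allI finite_measure_mono sample_event)
  qed (simp add: h_def)
  have h_infinite: "(\<lambda>n. 1 - h S n) \<longlonglongrightarrow> 0" if "infinite S" for S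
  proof (rule tendsto_sandwich[OF _ _ tendsto_const cons[of S]])
    have "{z. \<not> heavy n (map (copying c S z) [1..int n])} \<subseteq>
        {z. hamming_dist \<phi> (T_est n (map (copying c S z) [1..int n])) (context_tree (law S)) > ennreal 1}" for n
    proof clarify
      fix z assume light: "\<not> heavy n (map (copying c S z) [1..int n])"
      have "\<infinity> \<le> hamming_dist \<phi> (T_est n (map (copying c S z) [1..int n])) (context_tree (law S))
          + hamming_dist \<phi> (T_est n (map (copying c S z) [1..int n])) {}"
        using hamming_dist_triangle[of \<phi> "context_tree (law S)" "{}" "T_est n (map (copying c S z) [1..int n])"] \<phi>
        unfolding hamming_dist_empty_full[OF nodes_infinite_memory[OF that card]] divergent
        by (simp add: hamming_dist_sym[of \<phi> "context_tree (law S)"])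
      then have "hamming_dist \<phi> (T_est n (map (copying c S z) [1..int n])) (context_tree (law S)) = \<infinity>"
        using light by (simp add: heavy_def top_unique less_top[symmetric])
      then show "ennreal 1 < hamming_dist \<phi> (T_est n (map (copying c S z) [1..int n])) (context_tree (law S))"
        by simp
    qed
    moreover have "1 - h S n = prob {z. \<not> heavy n (map (copying c S z) [1..int n])}" for n
      unfolding h_def using prob_neg[of "\<lambda>z. heavy n (map (copying c S z) [1..int n])"] sample_event[of "heavy n" S n] by simp
    ultimately show "eventually (\<lambda>n. 1 - h S n \<le> \<P>(\<omega> in law S. hamming_dist \<phi> (T_est n (map \<omega> [1..int n])) (context_tree (law S)) > ennreal 1)) sequentially"
      unfolding law_sample[where F = "\<lambda>x. hamming_dist \<phi> (T_est n x) (context_tree (law S)) > ennreal 1" and n = n for n]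
      by (auto intro!: always_eventually finite_measure_mono sample_event)
  qed (simp add: h_def)
  have close: "h S' n \<le> h S n + prob (unresolved_sample n k)" if "S \<inter> {..<k} = S' \<inter> {..<k}" for S S' n k
  proof -
    have "{z. heavy n (map (copying c S' z) [1..int n])} \<subseteq>
        {z. heavy n (map (copying c S z) [1..int n])} \<union> unresolved_sample n k"
    proof
      fix z assume "z \<in> {z. heavy n (map (copying c S' z) [1..int n])}"
      then have z: "heavy n (map (copying c S' z) [1..int n])" by (rule CollectD)
      show "z \<in> {z. heavy n (map (copying c S z) [1..int n])} \<union> unresolved_sample n k"
      proof (cases "z \<in> unresolved_sample n k")
        case False
        from sample_eq_if_resolved[OF this that] z
        have "heavy n (map (copying c S z) [1..int n])" by (simp only:)
        then show ?thesis by simp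
      qed simp
    qed
    then have "h S' n \<le> prob ({z. heavy n (map (copying c S z) [1..int n])} \<union> unresolved_sample n k)"
      unfolding h_def by (intro finite_measure_mono sets.Un sample_event unresolved_sample_event)
    also have "\<dots> \<le> h S n + prob (unresolved_sample n k)"
      unfolding h_def by (intro measure_Un_le sample_event unresolved_sample_event)
    finally show ?thesis .
  qed
  \<comment> \<open>The state is the current finite set, a sample size, and the bound below which later elements must not lie.\<close>
  define good where "good j = (\<lambda>(S, n, k). finite S \<and> n \<ge> j \<and> S \<subseteq> {..<k} \<and> h S n < 1/4 \<and>
      prob (unresolved_sample n k) < 1/4)" for j :: nat
  have ex_good: "\<exists>n k. good j (S, n, k)" if fin: "finite S" for S j
  proof -
    have "eventually (\<lambda>n. h S n < 1/4) sequentially"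
      using h_finite[OF fin] by (rule order_tendstoD) simp
    then obtain N' where N': "\<And>n. n \<ge> N' \<Longrightarrow> h S n < 1/4"
      unfolding eventually_sequentially by blast
    define n where "n = max j N'"
    have n: "n \<ge> j" "h S n < 1/4" using N'[of n] by (auto simp: n_def)
    have "eventually (\<lambda>k. prob (unresolved_sample n k) < 1/4) sequentially"
      using unresolved_sample_vanishes by (rule order_tendstoD) simp
    then obtain N where N: "\<And>k. k \<ge> N \<Longrightarrow> prob (unresolved_sample n k) < 1/4"
      unfolding eventually_sequentially by blast
    obtain B where "S \<subseteq> {..<B}" using fin unfolding finite_nat_iff_bounded by blast
    then have "S \<subseteq> {..<max N B}" by auto
    then show ?thesis using n N[of "max N B"] fin by (auto simp: good_def)
  qed
  have "\<exists>f. \<forall>j. good j (f j) \<and> fst (f (Suc j)) = insert (snd (snd (f j))) (fst (f j))"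
  proof (rule dependent_nat_choice)
    show "\<exists>s. good 0 s" using ex_good[of "{}" 0] by blast
    fix s j assume "good j s"
    then have "finite (insert (snd (snd s)) (fst s))" by (auto simp: good_def)
    then obtain n k where "good (Suc j) (insert (snd (snd s)) (fst s), n, k)"
      using ex_good by blast
    then show "\<exists>s'. good (Suc j) s' \<and> fst s' = insert (snd (snd s)) (fst s)"
      by (intro exI[of _ "(insert (snd (snd s)) (fst s), n, k)"]) simp
  qed
  then obtain f where f: "\<And>j. good j (f j)"
    "\<And>j. fst (f (Suc j)) = insert (snd (snd (f j))) (fst (f j))" by blast
  define A where "A j = fst (f j)" for j
  define N where "N j = fst (snd (f j))" for j
  define K where "K j = snd (snd (f j))" for j
  have good: "N j \<ge> j" "A j \<subseteq> {..<K j}" "h (A j) (N j) < 1/4"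
      "prob (unresolved_sample (N j) (K j)) < 1/4" for j
    using f(1)[of j] by (auto simp: good_def A_def N_def K_def split_beta)
  have A_Suc: "A (Suc j) = insert (K j) (A j)" for j using f(2)[of j] by (simp add: A_def K_def)
  have K_mono: "strict_mono K"
    using good(2) A_Suc by (intro strict_monoI_Suc) auto
  define S where "S = A 0 \<union> range K"
  have A_eq: "A j = A 0 \<union> K ` {..<j}" for j
    by (induction j) (auto simp: A_Suc lessThan_Suc)
  have agree: "A j \<inter> {..<K j} = S \<inter> {..<K j}" for j
    using K_mono by (auto simp: A_eq[of j] S_def strict_mono_less)
  have "h S (N j) < 1/2" for j
    using close[OF agree[of j], of "N j"] good(3,4)[of j] by simp
  moreover have "infinite S"
    unfolding S_def using K_mono by (simp add: strict_mono_imp_inj_on range_inj_infinite)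
  then have "eventually (\<lambda>n. 1 - h S n < 1/2) sequentially"
    by (intro order_tendstoD(2)[OF h_infinite]) auto
  then obtain n0 where n0: "\<And>n. n \<ge> n0 \<Longrightarrow> 1 - h S n < 1/2"
    unfolding eventually_sequentially by blast
  ultimately have "1 - h S (N n0) < 1/2" "h S (N n0) < 1/2" using n0 good(1) by auto
  then show False by linarith
qed

end

theorem theorem2p8:
  fixes \<phi> :: "'a::finite list \<Rightarrow> real"
  assumes "CARD('a) \<ge> 2"
    and "\<And>v. \<phi> v \<ge> 0"
  shows "consistently_estimable \<phi> stationary_ergodic context_tree \<longleftrightarrow>
         (\<Sum>\<^sub>\<infinity>v\<in>UNIV. ennreal (\<phi> v)) < \<infinity>"
proof
  assume est: "consistently_estimable \<phi> stationary_ergodic context_tree"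
  then obtain T_est where T_est: "\<And>P \<epsilon>. P \<in> stationary_ergodic \<Longrightarrow> \<epsilon> > 0 \<Longrightarrow>
      (\<lambda>n. \<P>(\<omega> in P. hamming_dist \<phi> (T_est n (map \<omega> [1..int n])) (context_tree P) > ennreal \<epsilon>)) \<longlonglongrightarrow> 0"
    unfolding consistently_estimable_def by blast
  obtain q :: "('a + nat) pmf" where q: "set_pmf q = UNIV" using ex_full_support_pmf by blast
  \<comment> \<open>Any symbol serves as the default.\<close>
  interpret copying_process q undefined by unfold_locales (rule q)
  show "(\<Sum>\<^sub>\<infinity>v\<in>UNIV. ennreal (\<phi> v)) < \<infinity>"
  proof (rule ccontr)
    assume "\<not> ?thesis"
    then have "(\<Sum>\<^sub>\<infinity>v\<in>UNIV. ennreal (\<phi> v)) = \<infinity>" by (simp add: less_top[symmetric])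
    then show False
      by (rule not_estimable[where T_est = T_est, OF assms(2,1)]) (rule T_est[OF law_stationary_ergodic zero_less_one])
  qed
qed (rule summable_imp_estimable[OF assms(2)])

end
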